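(* For every $\varepsilon>0$, positive integers $s,d$, finite set $\mathcal{S}$ of size $s$ and Abelian group $G$, there is $L$ depending only on $\varepsilon,s,d$ such that for every $n$ the family $\mathcal{J}_d(\mathcal{S}^n,G)$ is $(1/s^d-\varepsilon,\ L)$-list decodable.
   Context: $\mathcal{J}_d(\mathcal{S}^n,G)$ is the set of functions $\mathcal{S}^n\to G$ that are sums of $d$-juntas (functions depending on at most $d$ coordinates). A family $\mathcal{F}$ of functions $D\to G$ is $(\varepsilon,L)$-list decodable if for every $f:D\to G$ there are at most $L$ functions $P\in\mathcal{F}$ with $\delta(f,P)\le\varepsilon$, where $\delta(f,P)$ is the fraction of inputs on which $f$ and $P$ differ. *)

theory Defs
  imports Complex_Main "HOL-Library.FuncSet" "HOL-Algebra.FiniteProduct"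
begin

definition cube :: "'a set \<Rightarrow> nat \<Rightarrow> (nat \<Rightarrow> 'a) set" where
  "cube S n = {..<n} \<rightarrow>\<^sub>E S"

definition depends_only_on :: "(nat \<Rightarrow> 'a) set \<Rightarrow> nat set \<Rightarrow> ((nat \<Rightarrow> 'a) \<Rightarrow> 'g) \<Rightarrow> bool" where
  "depends_only_on D I g \<longleftrightarrow> (\<forall>x\<in>D. \<forall>y\<in>D. (\<forall>i\<in>I. x i = y i) \<longrightarrow> g x = g y)"

text \<open>Functions on the cube are taken extensional, so that distinct elements of a family are
  distinct as functions on the cube. Groups are written multiplicatively, so sums in an Abelian
  group are expressed by \<^const>\<open>finprod\<close>.\<close>

definition juntas :: "nat \<Rightarrow> 'a set \<Rightarrow> nat \<Rightarrow> 'g monoid \<Rightarrow> ((nat \<Rightarrow> 'a) \<Rightarrow> 'g) set" where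
  "juntas d S n G = {g \<in> cube S n \<rightarrow>\<^sub>E carrier G.
     \<exists>I \<subseteq> {..<n}. card I \<le> d \<and> depends_only_on (cube S n) I g}"

definition junta_sums :: "nat \<Rightarrow> 'a set \<Rightarrow> nat \<Rightarrow> 'g monoid \<Rightarrow> ((nat \<Rightarrow> 'a) \<Rightarrow> 'g) set" where
  "junta_sums d S n G = {P. \<exists>(m::nat) g. (\<forall>j<m. g j \<in> juntas d S n G) \<and>
     P = (\<lambda>x\<in>cube S n. finprod G (\<lambda>j. g j x) {..<m})}"

definition rel_dist :: "'b set \<Rightarrow> ('b \<Rightarrow> 'g) \<Rightarrow> ('b \<Rightarrow> 'g) \<Rightarrow> real" where
  "rel_dist D f P = real (card {x \<in> D. f x \<noteq> P x}) / real (card D)"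

definition list_decodable ::
  "'b set \<Rightarrow> 'g set \<Rightarrow> ('b \<Rightarrow> 'g) set \<Rightarrow> real \<Rightarrow> nat \<Rightarrow> bool" where
  "list_decodable D R F r L \<longleftrightarrow>
     (\<forall>f \<in> D \<rightarrow> R. finite {P \<in> F. rel_dist D f P \<le> r} \<and> card {P \<in> F. rel_dist D f P \<le> r} \<le> L)"

text \<open>The list size \<open>L\<close> as a Skolem function of \<open>\<epsilon>\<close>, \<open>s\<close> and \<open>d\<close>. HOL cannot quantify over types
  below an existential quantifier, so a statement ``there is \<open>L\<close> such that for all \<open>S\<close> and \<open>G\<close>'' with
  \<open>S\<close>, \<open>G\<close> over type variables would let \<open>L\<close> vary with those types. A closed constant cannot do so:
  asserting list decodability with this constant for all \<open>S\<close> and \<open>G\<close> over arbitrary types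
  says that a single \<open>L\<close>, depending on \<open>\<epsilon>\<close>, \<open>s\<close>, \<open>d\<close> only, serves all of them.
  Choosing among the values that work for alphabets and groups with carriers in \<^typ>\<open>nat\<close> asks for nothing extra:
  a violation of the bound \<open>L\<close> over any group involves only \<open>L + 1\<close> functions, each a finite
  sum of juntas on a finite domain, and hence already occurs in a finitely generated,
  therefore countable, subgroup.\<close>

definition junta_list_size :: "real \<Rightarrow> nat \<Rightarrow> nat \<Rightarrow> nat" where
  "junta_list_size \<epsilon> s d = (SOME L. \<forall>(S :: nat set) (G :: nat monoid) n.
     finite S \<and> card S = s \<and> comm_group G \<longrightarrow>
     list_decodable (cube S n) (carrier G) (junta_sums d S n G) (1 / real s ^ d - \<epsilon>) L)"

end

theory Submission
  imports Defs "HOL-Algebra.Generated_Groups" "HOL-Library.Countable_Set"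
begin

text \<open>
  Write \<open>D\<^sub>j\<^sub>a\<^sub>b P (x) = P (x(j := a)) - P (x(j := b))\<close>. If \<open>P\<close> is a \<open>d\<close>-junta sum at distance at most
  \<open>s\<^bsup>-d\<^esup> - \<epsilon>\<close> from \<open>f\<close>, then \<open>D\<^sub>j\<^sub>a\<^sub>b P\<close> is a \<open>(d-1)\<close>-junta sum at distance at most
  \<open>s\<^bsup>-(d-1)\<^esup> - s\<epsilon>\<close> from \<open>D\<^sub>j\<^sub>a\<^sub>b f\<close>. By induction on \<open>d\<close>, the elements of the list for \<open>f\<close> therefore fall,
  for every coordinate \<open>j\<close>, into boundedly many classes modulo functions independent of \<open>j\<close>. A very
  long list then contains \<open>p\<^sub>0, \<dots>, p\<^sub>m\<close>, with coordinates \<open>c\<^sub>1, \<dots>, c\<^sub>m\<close>, such that \<open>p\<^sub>t - p\<^sub>0\<close> depends on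
  \<open>c\<^sub>t\<close> but \<open>p\<^sub>u - p\<^sub>0\<close> does not for \<open>u < t\<close>. By the Schwartz-Zippel bound, with probability at least
  \<open>s\<^bsup>-(d-1)\<^esup>\<close> the function \<open>p\<^sub>t - p\<^sub>0\<close> is nonconstant on the \<open>c\<^sub>t\<close>-line through a random point \<open>x\<close>, and
  then resampling \<open>x (c\<^sub>t)\<close> makes \<open>p\<^sub>t\<close> differ from any earlier \<open>p\<^sub>u\<close> with probability at least \<open>1/s\<close>. An
  exponential moment bound for each \<open>u\<close> and a union bound over \<open>u\<close>, the first index at which
  \<open>p\<^sub>u x = f x\<close>, show that on average at most a fraction \<open>1 - s\<^bsup>-d\<^esup> + o(1)\<close> of the \<open>p\<^sub>t\<close> agree with \<open>f\<close>,
  a contradiction.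

  The constant in the theorem is chosen for alphabets and groups on the natural numbers. It works
  for every \<open>S\<close> and \<open>G\<close>, because finitely many junta sums only involve a finitely generated, hence
  countable, subgroup of \<open>G\<close>.
\<close>

section \<open>Functions on the cube\<close>

lemma finite_cube: "finite S \<Longrightarrow> finite (cube S n)"
  by (simp add: cube_def finite_PiE)

lemma cube_nonempty: "S \<noteq> {} \<Longrightarrow> cube S n \<noteq> {}"
  by (simp add: cube_def PiE_eq_empty_iff)

lemma cube_upd: "x \<in> cube S n \<Longrightarrow> j < n \<Longrightarrow> a \<in> S \<Longrightarrow> x(j := a) \<in> cube S n"
  unfolding cube_def by (auto simp: PiE_iff extensional_def)

lemma cube_nth: "x \<in> cube S n \<Longrightarrow> j < n \<Longrightarrow> x j \<in> S"
  by (auto simp: cube_def)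

text \<open>Resampling coordinate \<open>j\<close>: each point of the cube arises from exactly
  \<open>card S\<close> pairs \<open>(x, a)\<close>. The witness map, which swaps the new value with
  the old one, is an involution.\<close>

lemma sum_cube_lines:
  fixes h :: "(nat \<Rightarrow> 'a) \<Rightarrow> 'b::comm_semiring_1"
  assumes "j < n"
  shows "(\<Sum>x\<in>cube S n. \<Sum>a\<in>S. h (x(j := a))) = of_nat (card S) * (\<Sum>x\<in>cube S n. h x)"
proof -
  have "(\<Sum>x\<in>cube S n. \<Sum>a\<in>S. h (x(j := a))) = (\<Sum>(x, a)\<in>cube S n \<times> S. h (x(j := a)))"
    by (simp add: sum.cartesian_product)
  also have "\<dots> = (\<Sum>(x, a)\<in>cube S n \<times> S. h x)"
    by (rule sum.reindex_bij_witness[where i = "\<lambda>(x, a). (x(j := a), x j)"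
          and j = "\<lambda>(x, a). (x(j := a), x j)"])
       (use assms in \<open>auto simp: cube_upd cube_nth\<close>)
  also have "\<dots> = (\<Sum>x\<in>cube S n. \<Sum>a\<in>S. h x)"
    by (simp only: sum.cartesian_product)
  finally show ?thesis
    by (simp add: sum_distrib_left)
qed

text \<open>Hybrid argument: \<open>z k\<close> takes its coordinates below \<open>k\<close> from
  \<open>y\<close> and the others from \<open>x\<close>, so consecutive hybrids lie on a common
  line.\<close>

lemma constant_if_line_invariant:
  assumes inv: "\<And>x j a. x \<in> cube S n \<Longrightarrow> j < n \<Longrightarrow> a \<in> S \<Longrightarrow> P (x(j := a)) = P x"
    and x: "x \<in> cube S n" and y: "y \<in> cube S n"
  shows "P x = P y"
proof -
  define z where "z k i = (if i < k then y i else x i)" for k i :: nat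
  have "z k \<in> cube S n \<and> P (z k) = P x" if "k \<le> n" for k
    using that
  proof (induction k)
    case 0
    then show ?case using x by (simp add: z_def[abs_def])
  next
    case (Suc k)
    have "z (Suc k) = (z k)(k := y k)"
      by (auto simp: z_def fun_eq_iff less_Suc_eq)
    moreover have "k < n" "y k \<in> S"
      using Suc.prems cube_nth[OF y] by auto
    ultimately show ?case
      using Suc inv[of "z k" k "y k"] cube_upd[of "z k" S n k "y k"] by (metis Suc_leD)
  qed
  moreover have "z n = y"
    using x y by (auto simp: z_def fun_eq_iff cube_def PiE_iff extensional_def)
  ultimately show ?thesis by force
qed

section \<open>Relative distance and counts of agreement\<close>

lemma rel_dist_sum:
  "finite D \<Longrightarrow> rel_dist D f P = (\<Sum>x\<in>D. of_bool (f x \<noteq> P x)) / real (card D)"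
  by (simp add: rel_dist_def sum_of_bool_eq Collect_conj_eq)

lemma card_agreement_eq:
  assumes "finite D" "D \<noteq> {}"
  shows "(\<Sum>x\<in>D. of_bool (P x = f x)) = real (card D) * (1 - rel_dist D f P)"
proof -
  have "(\<Sum>x\<in>D. of_bool (P x = f x)) + (\<Sum>x\<in>D. of_bool (f x \<noteq> P x)) = (\<Sum>x\<in>D. 1::real)"
    unfolding sum.distrib[symmetric] by (rule sum.cong) auto
  with assms show ?thesis
    by (simp add: rel_dist_sum algebra_simps card_gt_0_iff)
qed

text \<open>Double counting of agreements with \<open>f\<close>: each member of \<open>A\<close>
  contributes at least a fraction \<alpha> of \<open>D\<close>, while at each point at most one
  member can agree with \<open>f\<close>.\<close>

lemma card_nowhere_equal_le:
  fixes D :: "'b set" and A :: "('b \<Rightarrow> 'g) set"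
  assumes D: "finite D" "D \<noteq> {}" and A: "finite A"
    and ne: "\<And>P Q x. P \<in> A \<Longrightarrow> Q \<in> A \<Longrightarrow> P \<noteq> Q \<Longrightarrow> x \<in> D \<Longrightarrow> P x \<noteq> Q x"
    and dist: "\<And>P. P \<in> A \<Longrightarrow> rel_dist D f P \<le> 1 - \<alpha>"
  shows "real (card A) * \<alpha> \<le> 1"
proof -
  have "real (card A) * (real (card D) * \<alpha>) = (\<Sum>P\<in>A. real (card D) * \<alpha>)"
    by simp
  also have "\<dots> \<le> (\<Sum>P\<in>A. \<Sum>x\<in>D. of_bool (P x = f x))"
    unfolding card_agreement_eq[OF D] using dist by (intro sum_mono mult_left_mono) force+
  also have "\<dots> = (\<Sum>x\<in>D. \<Sum>P\<in>A. of_bool (P x = f x))"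
    by (rule sum.swap)
  also have "\<dots> \<le> (\<Sum>x\<in>D. 1)"
  proof (rule sum_mono)
    fix x assume "x \<in> D"
    then have "card (A \<inter> {P. P x = f x}) \<le> 1"
      using A ne unfolding card_le_Suc0_iff_eq[OF finite_Int[OF disjI1[OF A]]] One_nat_def
      by fastforce
    then show "(\<Sum>P\<in>A. of_bool (P x = f x)) \<le> (1::real)"
      using A by (simp add: sum_of_bool_eq)
  qed
  finally have "real (card D) * (real (card A) * \<alpha>) \<le> real (card D) * 1"
    by (simp add: mult_ac)
  then show ?thesis
    using D by (subst (asm) mult_le_cancel_left_pos) (auto simp: card_gt_0_iff)
qed

text \<open>Pigeonhole, with \<open>\<kappa> j P\<close> read as the class of \<open>P\<close> at
  coordinate \<open>j\<close>. If \<open>j\<close> separates two members of \<open>A\<close>, some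
  class at \<open>j\<close> still has more than \<open>K ^ m\<close> members; the induction runs
  inside that class, and a member outside it becomes the last term.\<close>

lemma separated_sequence:
  assumes K: "K \<ge> 1" and "finite A" "card A > K ^ m"
    and "\<And>j. j \<in> J \<Longrightarrow> card (\<kappa> j ` A) \<le> K"
    and "\<And>P Q. P \<in> A \<Longrightarrow> Q \<in> A \<Longrightarrow> P \<noteq> Q \<Longrightarrow> \<exists>j\<in>J. \<kappa> j P \<noteq> \<kappa> j Q"
  shows "\<exists>p c. (\<forall>t\<le>m. p t \<in> A) \<and> (\<forall>t\<in>{1..m}. c t \<in> J \<and> \<kappa> (c t) (p t) \<noteq> \<kappa> (c t) (p 0) \<and>
           (\<forall>u<t. \<kappa> (c t) (p u) = \<kappa> (c t) (p 0)))"
  using assms(2-)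
proof (induction m arbitrary: A)
  case 0
  then obtain P where "P \<in> A" by (metis card_gt_0_iff ex_in_conv power_0 zero_less_one order.strict_trans)
  then show ?case by (intro exI[of _ "\<lambda>_. P"]) auto
next
  case (Suc m)
  have "1 < card A"
    using Suc.prems(2) one_le_power[OF K, of "Suc m"] by linarith
  then obtain P Q where "P \<in> A" "Q \<in> A" "P \<noteq> Q"
    by (metis One_nat_def Suc.prems(1) card_le_Suc0_iff_eq not_le)
  then obtain j where j: "j \<in> J" "\<kappa> j P \<noteq> \<kappa> j Q"
    using Suc.prems(4) by blast
  have "\<exists>v\<in>\<kappa> j ` A. K ^ m < card {R \<in> A. \<kappa> j R = v}"
  proof (rule ccontr)
    assume "\<not> ?thesis"
    then have "(\<Sum>v\<in>\<kappa> j ` A. card {R \<in> A. \<kappa> j R = v}) \<le> (\<Sum>v\<in>\<kappa> j ` A. K ^ m)"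
      by (intro sum_mono) (auto simp: not_less)
    also have "\<dots> \<le> K ^ Suc m"
      using Suc.prems(3)[OF j(1)] by (simp add: mult_right_mono)
    also have "(\<Sum>v\<in>\<kappa> j ` A. card {R \<in> A. \<kappa> j R = v}) = card A"
      using sum.image_gen[OF Suc.prems(1), of "\<lambda>_. 1::nat" "\<kappa> j"] by simp
    finally show False using Suc.prems(2) by simp
  qed
  then obtain v where v: "K ^ m < card {R \<in> A. \<kappa> j R = v}" by blast
  let ?B = "{R \<in> A. \<kappa> j R = v}"
  have "finite ?B" using Suc.prems(1) by simp
  moreover have "card (\<kappa> i ` ?B) \<le> K" if "i \<in> J" for i
    by (rule order_trans[OF card_mono Suc.prems(3)[OF that]]) (use Suc.prems(1) in auto)
  moreover have "\<exists>i\<in>J. \<kappa> i P \<noteq> \<kappa> i Q" if "P \<in> ?B" "Q \<in> ?B" "P \<noteq> Q" for P Q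
    using Suc.prems(4) that by blast
  ultimately have "\<exists>p c. (\<forall>t\<le>m. p t \<in> ?B) \<and> (\<forall>t\<in>{1..m}. c t \<in> J \<and>
      \<kappa> (c t) (p t) \<noteq> \<kappa> (c t) (p 0) \<and> (\<forall>u<t. \<kappa> (c t) (p u) = \<kappa> (c t) (p 0)))"
    using v by (intro Suc.IH)
  then obtain p c where p: "\<forall>t\<le>m. p t \<in> ?B"
    and c: "\<forall>t\<in>{1..m}. c t \<in> J \<and> \<kappa> (c t) (p t) \<noteq> \<kappa> (c t) (p 0) \<and>
           (\<forall>u<t. \<kappa> (c t) (p u) = \<kappa> (c t) (p 0))"
    by blast
  obtain R where R: "R \<in> A" "\<kappa> j R \<noteq> v"
    using j \<open>P \<in> A\<close> \<open>Q \<in> A\<close> by metis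
  have pA: "p u \<in> A" and pv: "\<kappa> j (p u) = v" if "u \<le> m" for u
    using p that by auto
  define p' where "p' = p(Suc m := R)"
  define c' where "c' = c(Suc m := j)"
  have p': "p' (Suc m) = R" "\<And>t. t \<le> m \<Longrightarrow> p' t = p t"
    and c': "c' (Suc m) = j" "\<And>t. t \<le> m \<Longrightarrow> c' t = c t"
    by (auto simp: p'_def c'_def)
  have "p' t \<in> A" if "t \<le> Suc m" for t
    using that pA R p' by (cases "t = Suc m") auto
  moreover have "c' t \<in> J \<and> \<kappa> (c' t) (p' t) \<noteq> \<kappa> (c' t) (p' 0) \<and>
      (\<forall>u<t. \<kappa> (c' t) (p' u) = \<kappa> (c' t) (p' 0))" if "t \<in> {1..Suc m}" for t
  proof (cases "t = Suc m")
    case True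
    then show ?thesis using p' c' pv R j by auto
  next
    case False
    then have "t \<in> {1..m}" using that by auto
    moreover from this have "c' t = c t" "p' t = p t" "p' 0 = p 0" "\<forall>u<t. p' u = p u"
      using p' c' by auto
    ultimately show ?thesis using c by metis
  qed
  ultimately show ?case by blast
qed

section \<open>The exponential moment bound\<close>

lemma exp_le_quadratic:
  fixes z :: real
  assumes "\<bar>z\<bar> \<le> 1"
  shows "exp z \<le> 1 + z + z\<^sup>2"
proof (cases "z \<ge> 0")
  case True
  then show ?thesis using exp_bound[of z] assms by simp
next
  case False
  then have "1 - z > 0" by simp
  have "exp z * (1 - z) \<le> exp z * exp (- z)"
    using exp_ge_add_one_self[of "- z"] by (intro mult_left_mono) auto
  also have "\<dots> = 1" by (simp flip: exp_add)
  \<comment> \<open>The product telescopes to \<open>1 - z ^ 3\<close>, and \<open>z\<close> is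
    negative here.\<close>
  also have "1 \<le> (1 + z + z\<^sup>2) * (1 - z)"
  proof -
    have "z ^ 3 \<le> 0" using False by (simp add: power_le_zero_eq)
    then show ?thesis by (simp add: algebra_simps power2_eq_square power3_eq_cube)
  qed
  finally show ?thesis using \<open>1 - z > 0\<close> by (simp add: mult_le_cancel_right)
qed

text \<open>Averages out one factor: \<open>g\<close> is constant on each \<open>j\<close>-line and
  leaves the inner sum, so only line averages of \<open>h\<close> enter.\<close>

lemma sum_cube_mult_le:
  fixes g h :: "(nat \<Rightarrow> 'a) \<Rightarrow> real" and c :: real
  assumes S: "card S > 0" and j: "j < n"
    and g: "\<And>x. x \<in> cube S n \<Longrightarrow> g x \<ge> 0"
    and ginv: "\<And>x a. x \<in> cube S n \<Longrightarrow> a \<in> S \<Longrightarrow> g (x(j := a)) = g x"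
    and h: "\<And>x. x \<in> cube S n \<Longrightarrow> (\<Sum>a\<in>S. h (x(j := a))) \<le> card S * c"
  shows "(\<Sum>x\<in>cube S n. g x * h x) \<le> c * (\<Sum>x\<in>cube S n. g x)"
proof -
  have "card S * (\<Sum>x\<in>cube S n. g x * h x) = (\<Sum>x\<in>cube S n. \<Sum>a\<in>S. g (x(j := a)) * h (x(j := a)))"
    by (rule sum_cube_lines[OF j, symmetric])
  also have "\<dots> = (\<Sum>x\<in>cube S n. g x * (\<Sum>a\<in>S. h (x(j := a))))"
    by (simp add: ginv sum_distrib_left)
  also have "\<dots> \<le> (\<Sum>x\<in>cube S n. g x * (card S * c))"
    by (intro sum_mono mult_left_mono g h)
  also have "\<dots> = card S * (c * (\<Sum>x\<in>cube S n. g x))"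
    by (simp add: sum_distrib_left mult_ac)
  finally show ?thesis using S by (simp add: mult_le_cancel_left_pos)
qed

definition line_nonconst :: "'a set \<Rightarrow> nat \<Rightarrow> ((nat \<Rightarrow> 'a) \<Rightarrow> 'g) \<Rightarrow> (nat \<Rightarrow> 'a) \<Rightarrow> bool" where
  "line_nonconst S j Q x \<longleftrightarrow> (\<exists>a\<in>S. \<exists>b\<in>S. Q (x(j := a)) \<noteq> Q (x(j := b)))"

lemma line_nonconst_upd_same [simp]: "line_nonconst S j Q (x(j := a)) = line_nonconst S j Q x"
  by (simp add: line_nonconst_def)

lemma line_nonconst_upd:
  assumes "\<And>x a. x \<in> cube S n \<Longrightarrow> a \<in> S \<Longrightarrow> Q (x(i := a)) = Q x"
    and "x \<in> cube S n" "a \<in> S" "j < n"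
  shows "line_nonconst S j Q (x(i := a)) = line_nonconst S j Q x"
proof (cases "i = j")
  case False
  then show ?thesis
    using assms by (simp add: line_nonconst_def fun_upd_twist[of i j] cube_upd cong: bex_cong)
qed simp

text \<open>\<open>Z u t\<close> does not depend on \<open>c t'\<close> for \<open>t' > t\<close>, and its average over every \<open>c t\<close>-line is at
  most \<open>0\<close>, so that the factors can be averaged out one by one, the last one first.\<close>

lemma exponential_moment_le:
  fixes Q :: "nat \<Rightarrow> (nat \<Rightarrow> 'a) \<Rightarrow> 'g" and \<theta> :: real and S :: "'a set" and c :: "nat \<Rightarrow> nat"
  defines "Z \<equiv> \<lambda>u t x. of_bool (Q t x = Q u x) - 1 + of_bool (line_nonconst S (c t) (Q t) x) / card S"
  assumes S: "finite S" "S \<noteq> {}" and \<theta>: "0 \<le> \<theta>" "\<theta> \<le> 1"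
    and c: "\<And>t. t \<in> {1..m} \<Longrightarrow> c t < n"
    and indep: "\<And>t v x a. t \<in> {1..m} \<Longrightarrow> v < t \<Longrightarrow> x \<in> cube S n \<Longrightarrow> a \<in> S \<Longrightarrow> Q v (x(c t := a)) = Q v x"
    and "u \<le> k" "k \<le> m"
  shows "(\<Sum>x\<in>cube S n. \<Prod>t\<in>{u<..k}. exp (\<theta> * Z u t x)) \<le> (1 + \<theta>\<^sup>2) ^ k * card (cube S n)"
  using \<open>u \<le> k\<close> \<open>k \<le> m\<close>
proof (induction k rule: dec_induct)
  case base
  then show ?case by (simp add: mult_le_cancel_right1)
next
  case (step k)
  have k: "Suc k \<in> {1..m}" using step by auto
  have card: "real (card S) \<ge> 1" using S by (cases "card S") (auto simp: card_eq_0_iff)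
  have abs_Z: "\<bar>Z u t x\<bar> \<le> 1" for t x
    using card by (auto simp: Z_def field_simps)
  have Z_line: "(\<Sum>a\<in>S. Z u (Suc k) (x(c (Suc k) := a))) \<le> 0" if x: "x \<in> cube S n" for x
  proof (cases "line_nonconst S (c (Suc k)) (Q (Suc k)) x")
    case False
    then have "Z u (Suc k) (x(c (Suc k) := a)) \<le> 0" for a
      by (simp add: Z_def)
    then show ?thesis by (intro sum_nonpos)
  next
    case True
    \<comment> \<open>Values of the coordinate \<open>c (Suc k)\<close> at which
      \<open>Q (Suc k)\<close> hits \<open>Q u x\<close>, a target that is fixed along the line. As
      \<open>Q (Suc k)\<close> is not constant there, at least one value misses, which pays for the
      term \<open>1 / card S\<close> in \<open>Z\<close>.\<close>
    define B where "B = {a \<in> S. Q (Suc k) (x(c (Suc k) := a)) = Q u x}"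
    obtain a b where "a \<in> S" "b \<in> S" "a \<notin> B \<or> b \<notin> B"
      using True unfolding B_def line_nonconst_def mem_Collect_eq by metis
    then have "B \<subset> S"
      by (auto simp: B_def)
    then have "card B < card S" using S psubset_card_mono by blast
    have "(\<Sum>a\<in>S. Z u (Suc k) (x(c (Suc k) := a)))
        = (\<Sum>a\<in>S. of_bool (Q (Suc k) (x(c (Suc k) := a)) = Q u x) - 1 + 1 / card S)"
      using True indep[OF k _ x] step(1) by (intro sum.cong) (auto simp: Z_def)
    also have "\<dots> = real (card B) - real (card S) + 1"
      using S by (simp add: sum.distrib sum_subtractf sum_of_bool_eq B_def Collect_conj_eq)
    finally show ?thesis using \<open>card B < card S\<close> by linarith
  qed
  have line: "(\<Sum>a\<in>S. exp (\<theta> * Z u (Suc k) (x(c (Suc k) := a)))) \<le> card S * (1 + \<theta>\<^sup>2)"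
    if x: "x \<in> cube S n" for x
  proof -
    have "exp (\<theta> * Z u t y) \<le> 1 + \<theta> * Z u t y + \<theta>\<^sup>2" for t y
    proof -
      have "\<bar>\<theta> * Z u t y\<bar> \<le> 1"
        using abs_Z \<theta> by (simp add: abs_mult mult_le_one)
      moreover have "(\<theta> * Z u t y)\<^sup>2 \<le> \<theta>\<^sup>2"
        using abs_Z[of t y] by (simp add: power_mult_distrib mult_left_le abs_square_le_1)
      ultimately show ?thesis using exp_le_quadratic[of "\<theta> * Z u t y"] by linarith
    qed
    then have "(\<Sum>a\<in>S. exp (\<theta> * Z u (Suc k) (x(c (Suc k) := a))))
        \<le> (\<Sum>a\<in>S. 1 + \<theta> * Z u (Suc k) (x(c (Suc k) := a)) + \<theta>\<^sup>2)"
      by (intro sum_mono)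
    also have "\<dots> = card S * (1 + \<theta>\<^sup>2) + \<theta> * (\<Sum>a\<in>S. Z u (Suc k) (x(c (Suc k) := a)))"
      by (simp add: sum.distrib sum_distrib_left algebra_simps)
    also have "\<dots> \<le> card S * (1 + \<theta>\<^sup>2)"
      using Z_line[OF x] \<theta> by (simp add: mult_nonneg_nonpos)
    finally show ?thesis .
  qed
  have "{u<..Suc k} = insert (Suc k) {u<..k}" using step by auto
  then have "(\<Sum>x\<in>cube S n. \<Prod>t\<in>{u<..Suc k}. exp (\<theta> * Z u t x))
      = (\<Sum>x\<in>cube S n. (\<Prod>t\<in>{u<..k}. exp (\<theta> * Z u t x)) * exp (\<theta> * Z u (Suc k) x))"
    by (simp add: mult.commute)
  also have "\<dots> \<le> (1 + \<theta>\<^sup>2) * (\<Sum>x\<in>cube S n. \<Prod>t\<in>{u<..k}. exp (\<theta> * Z u t x))"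
  proof (rule sum_cube_mult_le[OF _ c[OF k] _ _ line])
    fix x a assume xa: "x \<in> cube S n" "a \<in> S"
    have "Z u t (x(c (Suc k) := a)) = Z u t x" if "t \<in> {u<..k}" for t
    proof -
      have t: "t \<in> {1..m}" "t < Suc k" "u < Suc k" using that step by auto
      show ?thesis
        unfolding Z_def using indep[OF k t(2) xa] indep[OF k t(3) xa]
          line_nonconst_upd[OF indep[OF k t(2)] xa c[OF t(1)]] by simp
    qed
    then show "(\<Prod>t\<in>{u<..k}. exp (\<theta> * Z u t (x(c (Suc k) := a)))) = (\<Prod>t\<in>{u<..k}. exp (\<theta> * Z u t x))"
      by simp
  qed (use S in \<open>auto simp: card_gt_0_iff intro: prod_nonneg\<close>)
  also have "\<dots> \<le> (1 + \<theta>\<^sup>2) * ((1 + \<theta>\<^sup>2) ^ k * card (cube S n))"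
    using step by (intro mult_left_mono) auto
  finally show ?case by simp
qed

text \<open>Let \<open>u\<close> be the first index with \<open>Q u x = f x\<close>. Beyond
  \<open>u\<close>, agreeing with \<open>f\<close> means agreeing with \<open>Q u\<close>, which the
  exponential moments control. The bound has 1 for \<open>u\<close> itself, the rate
  \<open>1 - q / card S\<close> for each index, and an error due to \<theta> and the
  \<open>m + 1\<close> candidates for \<open>u\<close>.\<close>

lemma sum_agreement_le:
  fixes Q :: "nat \<Rightarrow> (nat \<Rightarrow> 'a) \<Rightarrow> 'g" and \<theta> q :: real
  assumes S: "finite S" "S \<noteq> {}" and \<theta>: "0 < \<theta>" "\<theta> \<le> 1"
    and c: "\<And>t. t \<in> {1..m} \<Longrightarrow> c t < n"
    and indep: "\<And>t v x a. t \<in> {1..m} \<Longrightarrow> v < t \<Longrightarrow> x \<in> cube S n \<Longrightarrow> a \<in> S \<Longrightarrow> Q v (x(c t := a)) = Q v x"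
    and dep: "\<And>t. t \<in> {1..m} \<Longrightarrow>
      (\<Sum>x\<in>cube S n. of_bool (line_nonconst S (c t) (Q t) x)) \<ge> q * card (cube S n)"
  shows "(\<Sum>t\<le>m. \<Sum>x\<in>cube S n. of_bool (Q t x = f x))
      \<le> card (cube S n) * (1 + m * (1 - q / card S) + m * \<theta> + ln (real m + 1) / \<theta>)"
proof -
  let ?C = "cube S n"
  define E where "E t x = (of_bool (line_nonconst S (c t) (Q t) x) :: real)" for t x
  define Z where "Z u t x = of_bool (Q t x = Q u x) - 1 + E t x / card S" for u t x
  \<comment> \<open>The first agreeing index varies with \<open>x\<close>; summing over all
    \<open>u\<close> covers every case at once.\<close>
  define V where "V x = (\<Sum>u\<le>m. \<Prod>t\<in>{u<..m}. exp (\<theta> * Z u t x))" for x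
  \<comment> \<open>Chosen so that \<open>exp b\<close> bounds the average of \<open>V\<close>:
    \<open>m + 1\<close> summands, each at most \<open>(1 + \<theta>\<^sup>2) ^ m\<close> on
    average.\<close>
  define b where "b = m * \<theta>\<^sup>2 + ln (real m + 1)"
  have card: "real (card S) \<ge> 1" using S by (cases "card S") (auto simp: card_eq_0_iff)
  have E01: "0 \<le> 1 - E t x / card S" for t x using card by (simp add: E_def)
  have sumV: "(\<Sum>x\<in>?C. V x) \<le> exp b * card ?C"
  proof -
    have "(\<Sum>x\<in>?C. V x) = (\<Sum>u\<le>m. \<Sum>x\<in>?C. \<Prod>t\<in>{u<..m}. exp (\<theta> * Z u t x))"
      unfolding V_def by (rule sum.swap)
    also have "\<dots> \<le> (\<Sum>u\<le>m. (1 + \<theta>\<^sup>2) ^ m * card ?C)"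
      unfolding Z_def E_def using \<theta>
      by (intro sum_mono exponential_moment_le[where m = m] S c indep) auto
    also have "\<dots> = ((real m + 1) * (1 + \<theta>\<^sup>2) ^ m) * card ?C" by (simp add: add.commute)
    also have "\<dots> \<le> exp b * card ?C"
    proof (rule mult_right_mono)
      have "(1 + \<theta>\<^sup>2) ^ m \<le> exp (\<theta>\<^sup>2) ^ m"
        by (intro power_mono) (auto simp: add_nonneg_nonneg)
      then show "(real m + 1) * (1 + \<theta>\<^sup>2) ^ m \<le> exp b"
        by (simp add: b_def exp_add exp_of_nat_mult mult.commute)
    qed simp
    finally show ?thesis .
  qed
  have V_ge: "exp (\<theta> * (\<Sum>t\<in>{u<..m}. Z u t x)) \<le> V x" if "u \<le> m" for u x
    unfolding V_def sum_distrib_left exp_sum[OF finite_greaterThanAtMost]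
    by (rule member_le_sum) (use that in \<open>auto intro: prod_nonneg\<close>)
  \<comment> \<open>The tangent to \<open>exp\<close> at \<open>b\<close> replaces Jensen's inequality.\<close>
  have tangent: "v \<le> (b - 1 + exp (- b) * V x) / \<theta>" if "exp (\<theta> * v) \<le> V x" for v x
  proof -
    have "\<theta> * v - b + 1 \<le> exp (\<theta> * v - b)" using exp_ge_add_one_self[of "\<theta> * v - b"] by linarith
    also have "\<dots> = exp (- b) * exp (\<theta> * v)" by (simp add: exp_diff exp_minus field_simps)
    also have "\<dots> \<le> exp (- b) * V x" using that by simp
    finally show ?thesis using \<theta> by (simp add: pos_le_divide_eq algebra_simps)
  qed
  have pointwise: "(\<Sum>t\<le>m. of_bool (Q t x = f x))
      \<le> 1 + (\<Sum>t\<in>{1..m}. 1 - E t x / card S) + (b - 1 + exp (- b) * V x) / \<theta>" for x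
  proof (cases "\<exists>t\<le>m. Q t x = f x")
    case False
    \<comment> \<open>For \<open>u = m\<close> the sum of the \<open>Z\<close> is empty, so
      \<open>V x\<close> is at least 1 and the tangent bound applies with
      \<open>v = 0\<close>.\<close>
    have "0 \<le> (b - 1 + exp (- b) * V x) / \<theta>" using tangent[of 0 x] V_ge[of m x] by simp
    moreover have "(\<Sum>t\<le>m. of_bool (Q t x = f x)) = (0::real)" using False by (simp add: sum_nonneg_eq_0_iff)
    ultimately show ?thesis using sum_nonneg[of "{1..m}" "\<lambda>t. 1 - E t x / card S"] E01 by simp
  next
    case True
    obtain u where u: "u \<le> m" "Q u x = f x" and less: "\<forall>t<u. \<not> (t \<le> m \<and> Q t x = f x)"
      using True exists_least_iff[of "\<lambda>t. t \<le> m \<and> Q t x = f x"] by blast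
    have less: "Q t x \<noteq> f x" if "t < u" for t
      using less u that by auto
    have "{..m} = {..<u} \<union> (insert u {u<..m})" using u by auto
    then have "(\<Sum>t\<le>m. of_bool (Q t x = f x)) = (\<Sum>t\<in>{..<u}. of_bool (Q t x = f x))
        + (\<Sum>t\<in>insert u {u<..m}. of_bool (Q t x = f x) :: real)"
      by (simp only:) (rule sum.union_disjoint; auto)
    also have "\<dots> = 1 + (\<Sum>t\<in>{u<..m}. of_bool (Q t x = Q u x))"
      using less u by simp
    also have "(\<Sum>t\<in>{u<..m}. of_bool (Q t x = Q u x))
        = (\<Sum>t\<in>{u<..m}. 1 - E t x / card S) + (\<Sum>t\<in>{u<..m}. Z u t x)"
      by (simp add: Z_def flip: sum.distrib)
    also have "(\<Sum>t\<in>{u<..m}. 1 - E t x / card S) \<le> (\<Sum>t\<in>{1..m}. 1 - E t x / card S)"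
      using E01 by (intro sum_mono2) auto
    also have "(\<Sum>t\<in>{u<..m}. Z u t x) \<le> (b - 1 + exp (- b) * V x) / \<theta>"
      by (rule tangent[OF V_ge[OF u(1)]])
    finally show ?thesis by simp
  qed
  have "(\<Sum>t\<le>m. \<Sum>x\<in>?C. of_bool (Q t x = f x)) = (\<Sum>x\<in>?C. \<Sum>t\<le>m. of_bool (Q t x = f x) :: real)"
    by (rule sum.swap)
  also have "\<dots> \<le> (\<Sum>x\<in>?C. 1 + (\<Sum>t\<in>{1..m}. 1 - E t x / card S) + (b - 1 + exp (- b) * V x) / \<theta>)"
    by (intro sum_mono pointwise)
  also have "\<dots> = card ?C + (\<Sum>x\<in>?C. \<Sum>t\<in>{1..m}. 1 - E t x / card S)
      + (card ?C * (b - 1) + exp (- b) * (\<Sum>x\<in>?C. V x)) / \<theta>"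
    by (simp add: sum.distrib sum_distrib_left flip: sum_divide_distrib)
  also have "(\<Sum>x\<in>?C. \<Sum>t\<in>{1..m}. 1 - E t x / card S) = (\<Sum>t\<in>{1..m}. \<Sum>x\<in>?C. 1 - E t x / card S)"
    by (rule sum.swap)
  also have "\<dots> \<le> (\<Sum>t\<in>{1..m}. card ?C * (1 - q / card S))"
  proof (rule sum_mono)
    fix t assume "t \<in> {1..m}"
    from divide_right_mono[OF dep[OF this], of "card S"]
    show "(\<Sum>x\<in>?C. 1 - E t x / card S) \<le> card ?C * (1 - q / card S)"
      by (simp add: E_def sum_subtractf algebra_simps flip: sum_divide_distrib)
  qed
  \<comment> \<open>The averaged tangent bound thus becomes \<open>b / \<theta>\<close>, which is
    the error term \<open>m * \<theta> + ln (real m + 1) / \<theta>\<close>.\<close>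
  also have "exp (- b) * (\<Sum>x\<in>?C. V x) \<le> exp (- b) * (exp b * card ?C)"
    using sumV by simp
  also have "exp (- b) * (exp b * card ?C) = card ?C"
    by (simp add: exp_minus)
  finally show ?thesis
    using \<theta> by (simp add: b_def field_simps power2_eq_square)
qed

section \<open>Differences along lines\<close>

locale grid = comm_group G for G :: "'g monoid" (structure) +
  fixes S :: "'a set" and n :: nat
  assumes finite_S: "finite S" and S_nonempty: "S \<noteq> {}"
begin

abbreviation C :: "(nat \<Rightarrow> 'a) set" where "C \<equiv> cube S n"

lemma finite_C: "finite C" and C_nonempty: "C \<noteq> {}"
  using finite_S S_nonempty by (simp_all add: finite_cube cube_nonempty)

lemma card_C_pos: "card C > 0"
  using finite_C C_nonempty by (simp add: card_gt_0_iff)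

lemma card_S_ge_1: "real (card S) \<ge> 1"
  using finite_S S_nonempty by (cases "card S") auto

definition quot :: "((nat \<Rightarrow> 'a) \<Rightarrow> 'g) \<Rightarrow> ((nat \<Rightarrow> 'a) \<Rightarrow> 'g) \<Rightarrow> (nat \<Rightarrow> 'a) \<Rightarrow> 'g" where
  "quot P Q = (\<lambda>x\<in>C. P x \<otimes> inv Q x)"

definition diff :: "nat \<Rightarrow> 'a \<Rightarrow> 'a \<Rightarrow> ((nat \<Rightarrow> 'a) \<Rightarrow> 'g) \<Rightarrow> (nat \<Rightarrow> 'a) \<Rightarrow> 'g" where
  "diff j a b P = (\<lambda>x\<in>C. P (x(j := a)) \<otimes> inv P (x(j := b)))"

text \<open>Junta sums are only used through this recursive property, which they satisfy and which is
  stable under taking differences along lines.\<close>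

primrec low_degree :: "nat \<Rightarrow> ((nat \<Rightarrow> 'a) \<Rightarrow> 'g) \<Rightarrow> bool" where
  "low_degree 0 P \<longleftrightarrow> P \<in> C \<rightarrow>\<^sub>E carrier G \<and> (\<forall>x\<in>C. \<forall>y\<in>C. P x = P y)"
| "low_degree (Suc e) P \<longleftrightarrow> P \<in> C \<rightarrow>\<^sub>E carrier G \<and> (\<forall>j<n. \<forall>a\<in>S. \<forall>b\<in>S. low_degree e (diff j a b P))"

lemma low_degree_funcset: "low_degree e P \<Longrightarrow> P \<in> C \<rightarrow>\<^sub>E carrier G"
  by (cases e) auto

lemma low_degree_closed: "low_degree e P \<Longrightarrow> x \<in> C \<Longrightarrow> P x \<in> carrier G"
  using low_degree_funcset by blast

lemma diff_funcset:
  "P \<in> C \<rightarrow> carrier G \<Longrightarrow> j < n \<Longrightarrow> a \<in> S \<Longrightarrow> b \<in> S \<Longrightarrow> diff j a b P \<in> C \<rightarrow>\<^sub>E carrier G"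
  by (auto simp: diff_def Pi_iff cube_upd)

lemma quot_funcset:
  "P \<in> C \<rightarrow> carrier G \<Longrightarrow> Q \<in> C \<rightarrow> carrier G \<Longrightarrow> quot P Q \<in> C \<rightarrow>\<^sub>E carrier G"
  by (auto simp: quot_def Pi_iff)

lemma mult_inv_eq_one_iff: "x \<in> carrier G \<Longrightarrow> y \<in> carrier G \<Longrightarrow> x \<otimes> inv y = \<one> \<longleftrightarrow> x = y"
  by (metis inv_closed inv_equality inv_inv r_inv)

lemma diff_quot:
  assumes "P \<in> C \<rightarrow> carrier G" "Q \<in> C \<rightarrow> carrier G" "j < n" "a \<in> S" "b \<in> S"
  shows "diff j a b (quot P Q) = quot (diff j a b P) (diff j a b Q)"
proof
  fix x
  show "diff j a b (quot P Q) x = quot (diff j a b P) (diff j a b Q) x"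
  proof (cases "x \<in> C")
    case True
    have m: "P (x(j := a)) \<in> carrier G" "P (x(j := b)) \<in> carrier G"
       "Q (x(j := a)) \<in> carrier G" "Q (x(j := b)) \<in> carrier G"
      using assms True by (auto simp: Pi_iff cube_upd)
    then show ?thesis
      using True assms by (simp add: diff_def quot_def cube_upd inv_mult m_ac)
  qed (simp add: diff_def quot_def)
qed

lemma low_degree_quot: "low_degree e P \<Longrightarrow> low_degree e Q \<Longrightarrow> low_degree e (quot P Q)"
proof (induction e arbitrary: P Q)
  case 0
  then have "quot P Q \<in> C \<rightarrow>\<^sub>E carrier G"
    by (intro quot_funcset) (unfold low_degree.simps, blast+)
  moreover have "quot P Q x = quot P Q y" if "x \<in> C" "y \<in> C" for x y
    using 0 that unfolding quot_def low_degree.simps by (metis (no_types, lifting) restrict_apply)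
  ultimately show ?case unfolding low_degree.simps by blast
next
  case (Suc e)
  then have f: "P \<in> C \<rightarrow> carrier G" "Q \<in> C \<rightarrow> carrier G" by auto
  then show ?case using Suc quot_funcset[OF f] by (auto simp: diff_quot)
qed

lemma low_degree_one: "low_degree e (\<lambda>x\<in>C. \<one>)"
proof (induction e)
  case (Suc e)
  have "diff j a b (\<lambda>x\<in>C. \<one>) = (\<lambda>x\<in>C. \<one>)" if "j < n" "a \<in> S" "b \<in> S" for j a b
    using that by (auto simp: diff_def cube_upd)
  moreover have "(\<lambda>x\<in>C. \<one>) \<in> C \<rightarrow>\<^sub>E carrier G" by auto
  ultimately show ?case unfolding low_degree.simps using Suc by metis
qed auto

lemma low_degree_mult:
  assumes "low_degree e P" "low_degree e Q"
  shows "low_degree e (\<lambda>x\<in>C. P x \<otimes> Q x)"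
proof -
  \<comment> \<open>Closure under quotients suffices: a product is a quotient by an inverse.\<close>
  have "low_degree e (quot P (quot (\<lambda>x\<in>C. \<one>) Q))"
    using assms by (intro low_degree_quot low_degree_one)
  also have "quot P (quot (\<lambda>x\<in>C. \<one>) Q) = (\<lambda>x\<in>C. P x \<otimes> Q x)"
    using assms by (auto simp: quot_def low_degree_closed)
  finally show ?thesis .
qed

text \<open>A difference along \<open>j\<close> no longer depends on \<open>j\<close> if
  \<open>j\<close> is in \<open>I\<close>, and is constantly \<one> otherwise; in the second case
  the empty set serves as its set of coordinates.\<close>

lemma low_degree_junta:
  assumes "P \<in> C \<rightarrow>\<^sub>E carrier G" "I \<subseteq> {..<n}" "card I \<le> e" "depends_only_on C I P"
  shows "low_degree e P"
  using assms
proof (induction e arbitrary: P I)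
  case 0
  then have "I = {}" using finite_subset[of I "{..<n}"] by auto
  with 0 show ?case unfolding depends_only_on_def low_degree.simps by blast
next
  case (Suc e)
  have "low_degree e (diff j a b P)" if j: "j < n" "a \<in> S" "b \<in> S" for j a b
  proof (rule Suc.IH[of _ "if j \<in> I then I - {j} else {}"])
    show "diff j a b P \<in> C \<rightarrow>\<^sub>E carrier G"
      using Suc.prems j by (intro diff_funcset) auto
    show "card (if j \<in> I then I - {j} else {}) \<le> e"
      using Suc.prems finite_subset[of I "{..<n}"] by (simp add: le_diff_conv)
    show "depends_only_on C (if j \<in> I then I - {j} else {}) (diff j a b P)"
    proof (cases "j \<in> I")
      case True
      have L: "P (x(j := v)) = P (y(j := v))" if "x \<in> C" "y \<in> C" "\<forall>i\<in>I - {j}. x i = y i" "v \<in> S" for x y v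
      proof -
        have "\<forall>i\<in>I. (x(j := v)) i = (y(j := v)) i" using that by auto
        with that j Suc.prems show ?thesis unfolding depends_only_on_def by (meson cube_upd)
      qed
      have "diff j a b P x = diff j a b P y" if xy: "x \<in> C" "y \<in> C" "\<forall>i\<in>I - {j}. x i = y i" for x y
        using L[OF xy j(2)] L[OF xy j(3)] xy(1,2) by (simp add: diff_def)
      then show ?thesis unfolding depends_only_on_def if_P[OF True] by blast
    next
      case False
      have "P (x(j := v)) = P x" if "x \<in> C" "v \<in> S" for x v
      proof -
        have "\<forall>i\<in>I. (x(j := v)) i = x i" using False by auto
        with that j Suc.prems show ?thesis unfolding depends_only_on_def by (meson cube_upd)
      qed
      moreover have "P x \<in> carrier G" if "x \<in> C" for x using Suc.prems that by auto
      ultimately have "diff j a b P x = \<one>" if "x \<in> C" for x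
        using that j by (simp add: diff_def r_inv)
      then show ?thesis using False by (simp add: depends_only_on_def)
    qed
  qed (use Suc.prems in auto)
  then show ?case using Suc.prems by auto
qed

lemma low_degree_junta_sum:
  assumes "P \<in> junta_sums d S n G"
  shows "low_degree d P"
proof -
  obtain m :: nat and g where g: "\<forall>j<m. g j \<in> juntas d S n G"
    and P: "P = (\<lambda>x\<in>C. finprod G (\<lambda>j. g j x) {..<m})"
    using assms unfolding junta_sums_def by blast
  have gj: "low_degree d (g j)" if "j < m" for j
    using g that low_degree_junta unfolding juntas_def by blast
  have "low_degree d (\<lambda>x\<in>C. finprod G (\<lambda>j. g j x) {..<k})" if "k \<le> m" for k
    using that
  proof (induction k)
    case 0
    then show ?case using low_degree_one by (simp del: restrict_apply)
  next
    case (Suc k)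
    have "(\<lambda>x\<in>C. finprod G (\<lambda>j. g j x) {..<Suc k})
        = (\<lambda>x\<in>C. g k x \<otimes> (\<lambda>x\<in>C. finprod G (\<lambda>j. g j x) {..<k}) x)"
    proof (rule restrict_ext)
      fix x assume "x \<in> C"
      then show "finprod G (\<lambda>j. g j x) {..<Suc k}
          = g k x \<otimes> (\<lambda>x\<in>C. finprod G (\<lambda>j. g j x) {..<k}) x"
        using low_degree_closed[OF gj] Suc.prems unfolding lessThan_Suc
        by (subst finprod_insert) (auto simp: Pi_iff)
    qed
    moreover have "low_degree d (g k)"
      using Suc.prems by (intro gj) simp
    ultimately show ?case
      using low_degree_mult[OF _ Suc.IH[OF Suc_leD[OF Suc.prems]], of "g k"] by metis
  qed
  then show ?thesis unfolding P by blast
qed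

section \<open>What line differences reveal: zeros, distances and constancy\<close>

lemma line_invariant_iff_diff:
  assumes "P \<in> C \<rightarrow> carrier G" "j < n"
  shows "(\<forall>x\<in>C. \<forall>a\<in>S. P (x(j := a)) = P x) \<longleftrightarrow> (\<forall>a\<in>S. \<forall>b\<in>S. \<forall>x\<in>C. diff j a b P x = \<one>)"
proof -
  have "diff j a b P x = \<one> \<longleftrightarrow> P (x(j := a)) = P (x(j := b))" if "x \<in> C" "a \<in> S" "b \<in> S" for x a b
    using that assms by (simp add: diff_def mult_inv_eq_one_iff Pi_iff cube_upd)
  \<comment> \<open>\<open>x\<close> lies on its own \<open>j\<close>-line, so
    \<open>b = x j\<close> compares any point of the line with \<open>x\<close>.\<close>
  moreover have "P x = P (x(j := x j))" for x by simp
  ultimately show ?thesis using assms(2) cube_nth by (smt (verit, best))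
qed

text \<open>Both endpoints are among the \<open>card S\<close> points of the line, so summing
  \<open>N\<close> over whole lines costs a factor \<open>card S\<close>. This factor governs both
  the decoding radius and the Schwartz-Zippel density.\<close>

lemma sum_diff_le:
  fixes N :: "(nat \<Rightarrow> 'a) \<Rightarrow> bool"
  assumes j: "j < n" "a \<in> S" "b \<in> S" "a \<noteq> b"
    and imp: "\<And>x. x \<in> C \<Longrightarrow> M x \<Longrightarrow> N (x(j := a)) \<or> N (x(j := b))"
  shows "(\<Sum>x\<in>C. of_bool (M x)) \<le> card S * (\<Sum>x\<in>C. of_bool (N x) :: real)"
proof -
  have "(\<Sum>x\<in>C. of_bool (M x)) \<le> (\<Sum>x\<in>C. \<Sum>a\<in>S. of_bool (N (x(j := a))) :: real)"
  proof (rule sum_mono)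
    fix x assume "x \<in> C"
    then have "of_bool (M x) \<le> (\<Sum>a\<in>{a, b}. of_bool (N (x(j := a))) :: real)"
      using imp[of x] j(4) by (cases "M x") (auto simp: of_bool_def)
    also have "\<dots> \<le> (\<Sum>a\<in>S. of_bool (N (x(j := a))))"
      using j finite_S by (intro sum_mono2) auto
    finally show "of_bool (M x) \<le> (\<Sum>a\<in>S. of_bool (N (x(j := a))) :: real)" .
  qed
  also have "\<dots> = real (card S) * (\<Sum>x\<in>C. of_bool (N x))"
    by (rule sum_cube_lines[OF j(1)])
  finally show ?thesis .
qed

text \<open>Schwartz-Zippel. If some line difference of \<open>P\<close> is nontrivial, apply
  induction to it and lose a factor \<open>card S\<close>; otherwise \<open>P\<close> is
  constant.\<close>

lemma low_degree_nonzero_ge: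
  assumes "low_degree e P" "x \<in> C" "P x \<noteq> \<one>"
  shows "(\<Sum>x\<in>C. of_bool (P x \<noteq> \<one>)) \<ge> card C / real (card S) ^ e"
  using assms
proof (induction e arbitrary: P x)
  case 0
  then have "(\<Sum>x\<in>C. of_bool (P x \<noteq> \<one>)) = (\<Sum>x\<in>C. 1::real)"
    unfolding low_degree.simps by (intro sum.cong refl) (metis of_bool_eq(2))
  then show ?case by simp
next
  case (Suc e)
  have P: "P \<in> C \<rightarrow> carrier G" using Suc.prems by auto
  show ?case
  proof (cases "\<exists>j<n. \<exists>a\<in>S. \<exists>b\<in>S. \<exists>y\<in>C. diff j a b P y \<noteq> \<one>")
    case True
    then obtain j a b y where j: "j < n" "a \<in> S" "b \<in> S" "y \<in> C" "diff j a b P y \<noteq> \<one>"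
      by blast
    have "a \<noteq> b" using j P by (auto simp: diff_def cube_upd Pi_iff r_inv)
    have "card C / real (card S) ^ e \<le> (\<Sum>x\<in>C. of_bool (diff j a b P x \<noteq> \<one>))"
      using Suc.IH[of "diff j a b P" y] Suc.prems j by auto
    also have "\<dots> \<le> real (card S) * (\<Sum>x\<in>C. of_bool (P x \<noteq> \<one>))"
    proof (rule sum_diff_le[OF j(1-3) \<open>a \<noteq> b\<close>])
      fix x assume "x \<in> C" "diff j a b P x \<noteq> \<one>"
      then show "P (x(j := a)) \<noteq> \<one> \<or> P (x(j := b)) \<noteq> \<one>"
        by (auto simp: diff_def)
    qed
    finally show ?thesis using card_S_ge_1 by (simp add: field_simps)
  next
    case False
    then have "P (x(j := a)) = P x" if "x \<in> C" "j < n" "a \<in> S" for x j a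
      using line_invariant_iff_diff[OF P that(2)] that by blast
    then have "P y \<noteq> \<one>" if "y \<in> C" for y
      using constant_if_line_invariant[of S n P] that Suc.prems(2,3) by metis
    then have "(\<Sum>x\<in>C. of_bool (P x \<noteq> \<one>)) = (\<Sum>x\<in>C. 1::real)"
      by (intro sum.cong) auto
    moreover have "card C / real (card S) ^ Suc e \<le> card C / 1"
      using one_le_power[OF card_S_ge_1, of "Suc e"] by (intro divide_left_mono) auto
    ultimately show ?thesis by simp
  qed
qed

lemma rel_dist_diff_le:
  assumes "f \<in> C \<rightarrow> carrier G" "P \<in> C \<rightarrow> carrier G" "j < n" "a \<in> S" "b \<in> S"
  shows "rel_dist C (diff j a b f) (diff j a b P) \<le> card S * rel_dist C f P"
proof (cases "a = b")
  case True
  then have "{x \<in> C. diff j a b f x \<noteq> diff j a b P x} = {}"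
    using assms by (auto simp: diff_def Pi_iff cube_upd r_inv)
  then have "rel_dist C (diff j a b f) (diff j a b P) = 0"
    unfolding rel_dist_def by (simp only: card.empty)
  moreover have "0 \<le> card S * rel_dist C f P" by (simp add: rel_dist_def)
  ultimately show ?thesis by linarith
next
  case False
  have "(\<Sum>x\<in>C. of_bool (diff j a b f x \<noteq> diff j a b P x)) \<le> card S * (\<Sum>x\<in>C. of_bool (f x \<noteq> P x) :: real)"
    by (rule sum_diff_le[OF assms(3-) False]) (auto simp: diff_def)
  then show ?thesis
    unfolding rel_dist_sum[OF finite_C] times_divide_eq_right by (rule divide_right_mono) simp
qed

text \<open>The quotient of \<open>P\<close> and \<open>Q\<close> is invariant along all lines,
  hence constant, so one common value would make it trivial everywhere.\<close>

lemma equal_or_nowhere_equal: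
  assumes "low_degree e P" "low_degree e Q"
    and eq: "\<And>j a b. j < n \<Longrightarrow> a \<in> S \<Longrightarrow> b \<in> S \<Longrightarrow> diff j a b P = diff j a b Q"
    and ne: "P \<noteq> Q" and x: "x \<in> C"
  shows "P x \<noteq> Q x"
proof
  assume xeq: "P x = Q x"
  have P: "P \<in> C \<rightarrow>\<^sub>E carrier G" and Q: "Q \<in> C \<rightarrow>\<^sub>E carrier G"
    using assms(1,2) low_degree_funcset by auto
  then have PQ: "P \<in> C \<rightarrow> carrier G" "Q \<in> C \<rightarrow> carrier G" by auto
  have R: "quot P Q \<in> C \<rightarrow> carrier G" using quot_funcset[OF PQ] by auto
  have "diff j a b (quot P Q) y = \<one>" if "j < n" "a \<in> S" "b \<in> S" "y \<in> C" for j a b y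
    unfolding diff_quot[OF PQ that(1-3)] eq[OF that(1-3)]
    using diff_funcset[OF PQ(2) that(1-3)] that by (simp add: quot_def PiE_iff r_inv)
  then have "quot P Q (y(j := a)) = quot P Q y" if "y \<in> C" "j < n" "a \<in> S" for y j a
    using line_invariant_iff_diff[OF R that(2)] that by blast
  then have "quot P Q y = quot P Q x" if "y \<in> C" for y
    using constant_if_line_invariant[of S n "quot P Q"] that x by metis
  moreover have "quot P Q x = \<one>" using x PQ xeq by (simp add: quot_def Pi_iff r_inv)
  ultimately have "P y = Q y" if "y \<in> C" for y
    using that PQ mult_inv_eq_one_iff[of "P y" "Q y"] by (simp add: quot_def Pi_iff)
  then have "P = Q" by (rule PiE_ext[OF P Q])
  with ne show False by contradiction
qed

text \<open>Passes from the bound \<open>K\<close> on the number of line differences to a bound on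
  the list. Too large an \<open>A\<close> contains a separated sequence whose total agreement with
  \<open>f\<close> exceeds what \<open>sum_agreement_le\<close> permits.\<close>

lemma list_size_step:
  assumes f: "f \<in> C \<rightarrow> carrier G" and A: "finite A"
    and deg: "\<And>P. P \<in> A \<Longrightarrow> low_degree (Suc e) P"
    and dist: "\<And>P. P \<in> A \<Longrightarrow> rel_dist C f P \<le> 1 / real (card S) ^ Suc e - \<epsilon>"
    and K: "K \<ge> 1" "\<And>j a b. j < n \<Longrightarrow> a \<in> S \<Longrightarrow> b \<in> S \<Longrightarrow> card (diff j a b ` A) \<le> K"
    and \<theta>: "0 < \<theta>" "\<theta> \<le> 1" and m: "1 + real m * \<theta> + ln (real m + 1) / \<theta> < m * \<epsilon>"
    and S2: "card S \<ge> 2" and \<epsilon>: "\<epsilon> > 0"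
  shows "card A \<le> (K ^ (card S * card S)) ^ m"
proof (rule ccontr)
  assume "\<not> ?thesis"
  then have big: "card A > (K ^ (card S * card S)) ^ m" by simp
  \<comment> \<open>The class of \<open>P\<close> modulo functions independent of coordinate
    \<open>j\<close>, recorded by all \<open>card S * card S\<close> differences along
    \<open>j\<close>.\<close>
  define \<kappa> where "\<kappa> j P = (\<lambda>(a, b)\<in>S \<times> S. diff j a b P)" for j P
  have \<kappa>D: "diff j a b P = diff j a b Q" if "\<kappa> j P = \<kappa> j Q" "a \<in> S" "b \<in> S" for j a b P Q
    using fun_cong[OF that(1), of "(a, b)"] that by (simp add: \<kappa>_def)
  have fin_SS: "finite (S \<times> S)" using finite_S by simp
  have K': "card (\<kappa> j ` A) \<le> K ^ (card S * card S)" if "j \<in> {..<n}" for j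
  proof -
    let ?B = "\<lambda>(a, b). diff j a b ` A"
    have "card (\<kappa> j ` A) \<le> card (PiE (S \<times> S) ?B)"
      by (rule card_mono) (use A fin_SS in \<open>auto simp: \<kappa>_def intro!: finite_PiE\<close>)
    also have "\<dots> = (\<Prod>p\<in>S \<times> S. card (?B p))" by (rule card_PiE[OF fin_SS])
    also have "\<dots> \<le> (\<Prod>p\<in>S \<times> S. K)" using K(2) that by (intro prod_mono) auto
    also have "\<dots> = K ^ (card S * card S)" by (simp add: card_cartesian_product)
    finally show ?thesis .
  qed
  have s: "real (card S) \<ge> 2" using S2 by simp
  \<comment> \<open>This is the rate \<open>1 - q / card S\<close> of
    \<open>sum_agreement_le\<close> for \<open>q = 1 / card S ^ e\<close>; the radius forces
    agreement at least \<open>w + \<epsilon>\<close>.\<close>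
  define w where "w = 1 - 1 / real (card S) ^ Suc e"
  have "real (card S) ^ Suc e \<ge> 2 ^ Suc e" using s by (intro power_mono) auto
  moreover have "(2::real) ^ Suc e \<ge> 2" by simp
  ultimately have "real (card S) ^ Suc e \<ge> 2" by linarith
  then have "1 / real (card S) ^ Suc e \<le> 1 / 2"
    by (intro divide_left_mono) linarith+
  then have w: "w \<ge> 1 / 2" by (simp add: w_def)
  have dist': "rel_dist C f P \<le> 1 - (w + \<epsilon>)" if "P \<in> A" for P
    using dist[OF that] by (simp add: w_def)
  have sep: "\<exists>j\<in>{..<n}. \<kappa> j P \<noteq> \<kappa> j Q" if PQ: "P \<in> A" "Q \<in> A" "P \<noteq> Q" for P Q
  proof (rule ccontr)
    assume "\<not> ?thesis"
    then have eq: "diff j a b P = diff j a b Q" if "j < n" "a \<in> S" "b \<in> S" for j a b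
      using \<kappa>D that by blast
    have "P x \<noteq> Q x" if "x \<in> C" for x
      using equal_or_nowhere_equal[OF deg deg eq] PQ that by blast
    \<comment> \<open>Nowhere equal functions cannot both agree with \<open>f\<close> on more than
      half of the cube, and \<open>w + \<epsilon>\<close> exceeds 1/2.\<close>
    then have "real (card {P, Q}) * (w + \<epsilon>) \<le> 1"
      by (intro card_nowhere_equal_le[OF finite_C C_nonempty]) (use dist' PQ in force)+
    with PQ w \<epsilon> show False by simp
  qed
  have "K ^ (card S * card S) \<ge> 1" using K by simp
  from separated_sequence[OF this A big K' sep]
  obtain p c where p: "\<forall>t\<le>m. p t \<in> A" and c: "\<forall>t\<in>{1..m}. c t \<in> {..<n} \<and>
      \<kappa> (c t) (p t) \<noteq> \<kappa> (c t) (p 0) \<and> (\<forall>u<t. \<kappa> (c t) (p u) = \<kappa> (c t) (p 0))"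
    by blast
  have p_fun: "p t \<in> C \<rightarrow>\<^sub>E carrier G" if "t \<le> m" for t
    using p that deg low_degree_funcset by blast
  then have p_fun': "p t \<in> C \<rightarrow> carrier G" if "t \<le> m" for t using that by blast
  \<comment> \<open>Dividing by \<open>p 0\<close> turns equality of classes into invariance along
    lines; the received word becomes \<open>quot f (p 0)\<close>.\<close>
  define Q where "Q t = quot (p t) (p 0)" for t
  have Q_deg: "low_degree (Suc e) (Q t)" if "t \<le> m" for t
    unfolding Q_def using p that deg by (intro low_degree_quot) auto
  have Q_fun: "Q t \<in> C \<rightarrow> carrier G" if "t \<le> m" for t
    using low_degree_funcset[OF Q_deg[OF that]] by blast
  have ct: "c t < n" if "t \<in> {1..m}" for t using c that by blast
  have diffQ: "diff (c t) a b (Q u) x = \<one> \<longleftrightarrow> diff (c t) a b (p u) x = diff (c t) a b (p 0) x"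
    if "t \<in> {1..m}" "u \<le> m" "a \<in> S" "b \<in> S" "x \<in> C" for t u a b x
  proof -
    have "diff (c t) a b (p u) \<in> C \<rightarrow>\<^sub>E carrier G" "diff (c t) a b (p 0) \<in> C \<rightarrow>\<^sub>E carrier G"
      using that ct by (intro diff_funcset p_fun'; simp)+
    then show ?thesis
      using that ct unfolding Q_def
      by (subst diff_quot) (auto simp: p_fun' quot_def PiE_iff mult_inv_eq_one_iff)
  qed
  have indep: "Q v (x(c t := a)) = Q v x" if "t \<in> {1..m}" "v < t" "x \<in> C" "a \<in> S" for t v x a
  proof -
    have v: "v \<le> m" using that by simp
    have "\<kappa> (c t) (p v) = \<kappa> (c t) (p 0)" using c that by blast
    then have "\<forall>a\<in>S. \<forall>b\<in>S. \<forall>x\<in>C. diff (c t) a b (Q v) x = \<one>"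
      using diffQ[OF that(1) v] \<kappa>D by metis
    with line_invariant_iff_diff[OF Q_fun[OF v] ct[OF that(1)]] that show ?thesis by blast
  qed
  have dep: "(\<Sum>x\<in>C. of_bool (line_nonconst S (c t) (Q t) x)) \<ge> (1 / real (card S) ^ e) * card C"
    if t: "t \<in> {1..m}" for t
  proof -
    have tm: "t \<le> m" using t by simp
    have "\<exists>a\<in>S. \<exists>b\<in>S. diff (c t) a b (p t) \<noteq> diff (c t) a b (p 0)"
    proof (rule ccontr)
      assume "\<not> ?thesis"
      then have "\<kappa> (c t) (p t) = \<kappa> (c t) (p 0)" unfolding \<kappa>_def by (intro restrict_ext) auto
      with c t show False by blast
    qed
    then obtain a b where ab: "a \<in> S" "b \<in> S" and ne: "diff (c t) a b (p t) \<noteq> diff (c t) a b (p 0)"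
      by blast
    have "\<exists>y\<in>C. diff (c t) a b (p t) y \<noteq> diff (c t) a b (p 0) y"
    proof (rule ccontr)
      assume "\<not> ?thesis"
      then have "diff (c t) a b (p t) = diff (c t) a b (p 0)"
        using tm ab ct[OF t] by (intro PiE_ext[OF diff_funcset[OF p_fun'] diff_funcset[OF p_fun']]) auto
      with ne show False by contradiction
    qed
    then obtain y where y: "y \<in> C" "diff (c t) a b (Q t) y \<noteq> \<one>"
      using diffQ[OF t tm ab] by blast
    \<comment> \<open>The difference has degree one less, so Schwartz-Zippel gives density
      \<open>1 / card S ^ e\<close>. A further factor \<open>1 / card S\<close> comes from
      resampling in \<open>sum_agreement_le\<close>.\<close>
    have "low_degree e (diff (c t) a b (Q t))" using Q_deg[OF tm] ct[OF t] ab by simp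
    from low_degree_nonzero_ge[OF this y]
    have "(1 / real (card S) ^ e) * card C \<le> (\<Sum>x\<in>C. of_bool (diff (c t) a b (Q t) x \<noteq> \<one>))" by simp
    also have "\<dots> \<le> (\<Sum>x\<in>C. of_bool (line_nonconst S (c t) (Q t) x))"
    proof (rule sum_mono)
      fix x assume x: "x \<in> C"
      have "line_nonconst S (c t) (Q t) x" if "diff (c t) a b (Q t) x \<noteq> \<one>"
      proof -
        have "Q t (x(c t := a)) \<noteq> Q t (x(c t := b))"
          using that x ab ct[OF t] Q_fun[OF tm] by (auto simp: diff_def Pi_iff cube_upd r_inv)
        then show ?thesis unfolding line_nonconst_def using ab by blast
      qed
      then show "of_bool (diff (c t) a b (Q t) x \<noteq> \<one>) \<le> (of_bool (line_nonconst S (c t) (Q t) x) :: real)"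
        by auto
    qed
    finally show ?thesis .
  qed
  have agree: "(\<Sum>x\<in>C. of_bool (Q t x = quot f (p 0) x)) \<ge> card C * (w + \<epsilon>)" if "t \<le> m" for t
  proof -
    have "card C * (w + \<epsilon>) \<le> card C * (1 - rel_dist C f (p t))"
      using dist'[of "p t"] p that by (intro mult_left_mono) auto
    also have "\<dots> = (\<Sum>x\<in>C. of_bool (p t x = f x))"
      by (rule card_agreement_eq[OF finite_C C_nonempty, symmetric])
    also have "\<dots> = (\<Sum>x\<in>C. of_bool (Q t x = quot f (p 0) x))"
    proof (rule sum.cong)
      fix x assume x: "x \<in> C"
      then have "p t x \<in> carrier G" "p 0 x \<in> carrier G" "f x \<in> carrier G"
        using p_fun'[OF that] p_fun'[of 0] f by (auto simp: Pi_iff)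
      then show "of_bool (p t x = f x) = (of_bool (Q t x = quot f (p 0) x) :: real)"
        using x by (simp add: Q_def quot_def)
    qed simp
    finally show ?thesis .
  qed
  have "card C * ((m + 1) * (w + \<epsilon>)) = (\<Sum>t\<le>m. card C * (w + \<epsilon>))" by (simp add: algebra_simps)
  also have "\<dots> \<le> (\<Sum>t\<le>m. \<Sum>x\<in>C. of_bool (Q t x = quot f (p 0) x))"
    by (rule sum_mono, rule agree) simp
  also have "\<dots> \<le> card C * (1 + m * (1 - (1 / real (card S) ^ e) / card S) + m * \<theta> + ln (real m + 1) / \<theta>)"
    by (rule sum_agreement_le[OF finite_S S_nonempty \<theta> ct indep dep])
  also have "1 - (1 / real (card S) ^ e) / card S = w" by (simp add: w_def field_simps)
  finally have "(m + 1) * (w + \<epsilon>) \<le> 1 + m * w + m * \<theta> + ln (real m + 1) / \<theta>"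
    using card_C_pos by (simp add: mult_le_cancel_left_pos)
  \<comment> \<open>The terms \<open>m * w\<close> cancel, and \<open>m * \<epsilon>\<close> alone
    exceeds the rest of the right-hand side by the choice of \<open>m\<close>.\<close>
  with m w \<epsilon> show False by (simp add: algebra_simps)
qed

end

section \<open>Choice of parameters and induction on the degree\<close>

lemma exists_length_beating_error:
  fixes \<epsilon> :: real
  assumes "\<epsilon> > 0"
  obtains \<theta> :: real and m :: nat
  where "0 < \<theta>" "\<theta> \<le> 1" "1 + real m * \<theta> + ln (real m + 1) / \<theta> < m * \<epsilon>"
proof -
  \<comment> \<open>Keeps \<open>m * \<theta>\<close> within a quarter of
    \<open>m * \<epsilon>\<close>; for large \<open>m\<close> the logarithmic term takes about
    another quarter.\<close>
  define \<theta> where "\<theta> = min 1 (\<epsilon> / 4)"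
  have \<theta>: "0 < \<theta>" "\<theta> \<le> 1" "\<theta> \<le> \<epsilon> / 4" using assms by (auto simp: \<theta>_def)
  have "(\<lambda>m. ln (real m) / real m) \<longlonglongrightarrow> 0"
    by (rule filterlim_compose[OF ln_x_over_x_tendsto_0 filterlim_real_sequentially])
  then have "eventually (\<lambda>m. ln (real m) / real m < \<epsilon> * \<theta> / 4) sequentially"
    using assms \<theta> by (intro order_tendstoD) auto
  moreover have "eventually (\<lambda>m. real m > max 2 (8 / \<epsilon>)) sequentially"
    using filterlim_real_sequentially unfolding filterlim_at_top_dense by blast
  ultimately have "eventually (\<lambda>m. ln (real m) / real m < \<epsilon> * \<theta> / 4 \<and> real m > max 2 (8 / \<epsilon>)) sequentially"
    by (rule eventually_conj)
  then obtain k where k: "ln (real k) / real k < \<epsilon> * \<theta> / 4" "real k > 2" "real k > 8 / \<epsilon>"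
    by (auto simp: eventually_sequentially)
  \<comment> \<open>The shift makes \<open>real m + 1\<close> equal to \<open>real k\<close>. The
    lower bounds \<open>2\<close> and \<open>8 / \<epsilon>\<close> on \<open>k\<close> absorb this
    shift and the summand 1.\<close>
  define m where "m = k - 1"
  have mk: "real k = real m + 1" using k by (simp add: m_def of_nat_diff)
  have "ln (real m + 1) < (\<epsilon> / 4 * real k) * \<theta>"
    using k mk by (simp add: field_simps)
  then have "ln (real m + 1) / \<theta> < \<epsilon> / 4 * real k" using \<theta> by (simp add: pos_divide_less_eq)
  moreover have "real m * \<theta> \<le> real m * (\<epsilon> / 4)" using \<theta> by (intro mult_left_mono) auto
  moreover have "8 < real k * \<epsilon>" using k assms by (simp add: field_simps)
  moreover have "2 * \<epsilon> < real k * \<epsilon>" using k assms by simp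
  ultimately have "1 + real m * \<theta> + ln (real m + 1) / \<theta> < m * \<epsilon>"
    using mk by (simp add: algebra_simps)
  with \<theta> that show ?thesis by blast
qed

text \<open>Induction over \<open>low_degree\<close> functions, a class that differencing maps to
  the next lower degree. Since \<open>L\<close> is chosen before \<open>n\<close> and
  \<open>f\<close>, it serves all the words \<open>diff j a b f\<close> at once.\<close>

lemma exists_list_size:
  assumes "s > 0" "\<epsilon> > 0"
  shows "\<exists>L. \<forall>(S :: 'a set) (G :: 'g monoid) n f A.
    finite S \<and> card S = s \<and> comm_group G \<and> f \<in> cube S n \<rightarrow> carrier G \<and> finite A \<and>
    (\<forall>P\<in>A. grid.low_degree G S n d P \<and> rel_dist (cube S n) f P \<le> 1 / real s ^ d - \<epsilon>) \<longrightarrow> card A \<le> L"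
  using assms(2)
proof (induction d arbitrary: \<epsilon>)
  case 0
  show ?case
  proof (intro exI[of _ "nat \<lceil>1 / \<epsilon>\<rceil>"] allI impI, elim conjE)
    fix S :: "'a set" and G :: "'g monoid" and n f A
    assume S: "finite S" "card S = s" and "comm_group G" and A: "finite A"
      and *: "\<forall>P\<in>A. grid.low_degree G S n 0 P \<and> rel_dist (cube S n) f P \<le> 1 / real s ^ 0 - \<epsilon>"
    interpret comm_group G by fact
    interpret grid G S n using S assms(1) by unfold_locales auto
    \<comment> \<open>Constants that meet anywhere coincide, and each agrees with \<open>f\<close>
      on a fraction at least \<epsilon>.\<close>
    have "real (card A) * \<epsilon> \<le> 1"
    proof (rule card_nowhere_equal_le[OF finite_C C_nonempty A])
      fix P Q x assume PQ: "P \<in> A" "Q \<in> A" "P \<noteq> Q" "x \<in> C"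
      show "P x \<noteq> Q x"
      proof
        assume eq: "P x = Q x"
        have "P \<in> C \<rightarrow>\<^sub>E carrier G" "Q \<in> C \<rightarrow>\<^sub>E carrier G"
          using * PQ low_degree_funcset by blast+
        moreover have "P y = Q y" if "y \<in> C" for y
          using * PQ eq that unfolding low_degree.simps by metis
        ultimately have "P = Q" by (rule PiE_ext)
        with PQ show False by blast
      qed
    qed (use * in auto)
    then show "card A \<le> nat \<lceil>1 / \<epsilon>\<rceil>"
      using 0 by (simp add: le_nat_iff le_ceiling_iff field_simps)
  qed
next
  case (Suc d)
  \<comment> \<open>Differencing multiplies the distance by at most \<open>s\<close>, and
    \<open>s * (1 / s ^ Suc d - \<epsilon>)\<close> is the radius for \<open>d\<close> with
    \<open>s * \<epsilon>\<close> in place of \<epsilon>.\<close>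
  have "real s * \<epsilon> > 0" using Suc.prems assms by simp
  from Suc.IH[OF this] obtain L where L: "\<forall>(S :: 'a set) (G :: 'g monoid) n f A.
    finite S \<and> card S = s \<and> comm_group G \<and> f \<in> cube S n \<rightarrow> carrier G \<and> finite A \<and>
    (\<forall>P\<in>A. grid.low_degree G S n d P \<and> rel_dist (cube S n) f P \<le> 1 / real s ^ d - real s * \<epsilon>)
      \<longrightarrow> card A \<le> L" ..
  obtain \<theta> :: real and m :: nat
    where m: "0 < \<theta>" "\<theta> \<le> 1" "1 + real m * \<theta> + ln (real m + 1) / \<theta> < m * \<epsilon>"
    using exists_length_beating_error[OF Suc.prems] by blast
  define K where "K = max 1 L"
  show ?case
  proof (intro exI[of _ "(K ^ (s * s)) ^ m"] allI impI, elim conjE)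
    fix S :: "'a set" and G :: "'g monoid" and n f A
    assume S: "finite S" "card S = s" and G: "comm_group G" and f: "f \<in> cube S n \<rightarrow> carrier G"
      and A: "finite A"
      and *: "\<forall>P\<in>A. grid.low_degree G S n (Suc d) P \<and> rel_dist (cube S n) f P \<le> 1 / real s ^ Suc d - \<epsilon>"
    interpret comm_group G by fact
    interpret grid G S n using S assms(1) by unfold_locales auto
    show "card A \<le> (K ^ (s * s)) ^ m"
    proof (cases "s = 1")
      \<comment> \<open>With one letter the cube is a single point, and a distance below 1 forces
        equality with \<open>f\<close>.\<close>
      case True
      have "card C = 1" using S True by (simp add: cube_def card_PiE)
      then obtain z where z: "C = {z}" by (auto simp: card_1_singleton_iff)
      have "P = (\<lambda>x\<in>C. f x)" if "P \<in> A" for P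
      proof (rule PiE_ext)
        have "rel_dist C f P < 1" using * that True Suc.prems by force
        then have "f z = P z" by (rule contrapos_pp) (simp add: rel_dist_sum z)
        then show "P x = (\<lambda>x\<in>C. f x) x" if "x \<in> C" for x using that z by simp
        show "P \<in> C \<rightarrow>\<^sub>E carrier G" using * that low_degree_funcset by blast
      qed (use f in auto)
      then have "card A \<le> 1" unfolding One_nat_def card_le_Suc0_iff_eq[OF A] by metis
      also have "1 \<le> (K ^ (s * s)) ^ m" by (simp add: K_def)
      finally show ?thesis .
    next
      case False
      then have "card S \<ge> 2" using S assms by simp
      moreover have "card (diff j a b ` A) \<le> K" if j: "j < n" "a \<in> S" "b \<in> S" for j a b
      proof -
        have "card (diff j a b ` A) \<le> L"
        proof (rule L[rule_format], intro conjI S G)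
          show "diff j a b f \<in> C \<rightarrow> carrier G" using diff_funcset[OF f j] by blast
          show "\<forall>P\<in>diff j a b ` A. low_degree d P \<and> rel_dist C (diff j a b f) P \<le> 1 / real s ^ d - real s * \<epsilon>"
          proof
            fix D assume "D \<in> diff j a b ` A"
            then obtain P where P: "P \<in> A" "D = diff j a b P" by blast
            have "rel_dist C (diff j a b f) D \<le> s * rel_dist C f P"
              using rel_dist_diff_le[OF f _ j] low_degree_funcset[of "Suc d" P] * P S by blast
            also have "\<dots> \<le> s * (1 / real s ^ Suc d - \<epsilon>)" using * P by (intro mult_left_mono) auto
            also have "\<dots> = 1 / real s ^ d - real s * \<epsilon>" using assms by (simp add: field_simps)
            finally show "low_degree d D \<and> rel_dist C (diff j a b f) D \<le> 1 / real s ^ d - real s * \<epsilon>"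
              using * P j by auto
          qed
        qed (use A S G in auto)
        then show ?thesis by (simp add: K_def)
      qed
      ultimately show ?thesis
        using list_size_step[OF f A, where K = K and m = m and \<theta> = \<theta> and \<epsilon> = \<epsilon> and e = d] * m S Suc.prems
        by (auto simp: K_def)
    qed
  qed
qed

section \<open>Independence of the underlying types\<close>

lemma hom_finprod_lessThan:
  fixes m :: nat
  assumes "comm_group G" "comm_group H" "\<phi> \<in> hom G H" "\<And>j. j < m \<Longrightarrow> g j \<in> carrier G"
  shows "\<phi> (finprod G g {..<m}) = finprod H (\<lambda>j. \<phi> (g j)) {..<m}"
proof -
  interpret G: comm_group G by fact
  interpret H: comm_group H by fact
  show ?thesis
    using assms(4)
  proof (induction m)
    case 0
    show ?case using hom_one[OF assms(3) G.is_group H.is_group] by simp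
  next
    case (Suc m)
    have "finprod G g {..<m} \<in> carrier G" using Suc.prems by (intro G.finprod_closed) auto
    moreover have "finprod G g {..<Suc m} = g m \<otimes>\<^bsub>G\<^esub> finprod G g {..<m}"
      unfolding lessThan_Suc using Suc.prems by (intro G.finprod_insert) auto
    moreover have "finprod H (\<lambda>j. \<phi> (g j)) {..<Suc m}
        = \<phi> (g m) \<otimes>\<^bsub>H\<^esub> finprod H (\<lambda>j. \<phi> (g j)) {..<m}"
      unfolding lessThan_Suc using Suc.prems hom_in_carrier[OF assms(3)]
      by (intro H.finprod_insert) auto
    ultimately show ?case
      using Suc hom_mult[OF assms(3)] by simp
  qed
qed

lemma junta_sums_funcset:
  assumes "comm_group G" "P \<in> junta_sums d S n G"
  shows "P \<in> cube S n \<rightarrow>\<^sub>E carrier G"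
proof -
  interpret comm_group G by fact
  obtain m :: nat and g where "\<forall>j<m. g j \<in> juntas d S n G"
    and "P = (\<lambda>x\<in>cube S n. finprod G (\<lambda>j. g j x) {..<m})"
    using assms(2) unfolding junta_sums_def by blast
  then show ?thesis by (auto simp: juntas_def intro!: finprod_closed)
qed

text \<open>\<open>T\<close> reads a function through the bijection \<open>pull\<close> of cubes and
  the embedding \<phi> of groups. It preserves junta sums and distances and is injective on the
  list, so the list over \<open>G\<close> is no longer than one over \<open>H\<close>.\<close>

lemma list_decodable_transfer:
  fixes G :: "'g monoid" and H :: "'h monoid"
  assumes G: "comm_group G" and H: "comm_group H" and \<phi>: "\<phi> \<in> hom G H" "inj_on \<phi> (carrier G)"
    and \<beta>: "bij_betw \<beta> S' S"
    and ld: "list_decodable (cube S' n) (carrier H) (junta_sums d S' n H) r L"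
  shows "list_decodable (cube S n) (carrier G) (junta_sums d S n G) r L"
proof -
  let ?C = "cube S n" and ?C' = "cube S' n"
  define pull where "pull x = (\<lambda>i\<in>{..<n}. \<beta> (x i))" for x
  have pull: "bij_betw pull ?C' ?C"
  proof (rule bij_betw_byWitness[where f' = "\<lambda>x. \<lambda>i\<in>{..<n}. inv_into S' \<beta> (x i)"])
    show "\<forall>x\<in>?C'. (\<lambda>i\<in>{..<n}. inv_into S' \<beta> (pull x i)) = x"
    proof
      fix x assume x: "x \<in> ?C'"
      then show "(\<lambda>i\<in>{..<n}. inv_into S' \<beta> (pull x i)) = x"
        using cube_nth[OF x] bij_betw_inv_into_left[OF \<beta>]
        by (intro extensionalityI[of _ "{..<n}"]) (auto simp: pull_def cube_def PiE_iff)
    qed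
    show "\<forall>x\<in>?C. pull (\<lambda>i\<in>{..<n}. inv_into S' \<beta> (x i)) = x"
    proof
      fix x assume x: "x \<in> ?C"
      then show "pull (\<lambda>i\<in>{..<n}. inv_into S' \<beta> (x i)) = x"
        using cube_nth[OF x] bij_betw_inv_into_right[OF \<beta>]
        by (intro extensionalityI[of _ "{..<n}"]) (auto simp: pull_def cube_def PiE_iff)
    qed
    show "pull ` ?C' \<subseteq> ?C"
      using bij_betw_apply[OF \<beta>] by (auto simp: pull_def cube_def PiE_iff)
    show "(\<lambda>x. \<lambda>i\<in>{..<n}. inv_into S' \<beta> (x i)) ` ?C \<subseteq> ?C'"
      using bij_betw_apply[OF bij_betw_inv_into[OF \<beta>]] by (auto simp: cube_def PiE_iff)
  qed
  have pull_in: "pull x \<in> ?C" if "x \<in> ?C'" for x using pull that by (auto simp: bij_betw_def)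
  define T where "T P = (\<lambda>x\<in>?C'. \<phi> (P (pull x)))" for P
  have T_eq: "T P x = T Q x \<longleftrightarrow> P (pull x) = Q (pull x)"
    if "P \<in> ?C \<rightarrow> carrier G" "Q \<in> ?C \<rightarrow> carrier G" "x \<in> ?C'" for P Q x
    using that pull_in[of x] inj_on_eq_iff[OF \<phi>(2), of "P (pull x)" "Q (pull x)"]
    by (auto simp: T_def Pi_iff)
  have T_junta: "T g \<in> juntas d S' n H" if "g \<in> juntas d S n G" for g
  proof -
    obtain I where g: "g \<in> ?C \<rightarrow>\<^sub>E carrier G" and I: "I \<subseteq> {..<n}" "card I \<le> d" "depends_only_on ?C I g"
      using \<open>g \<in> juntas d S n G\<close> unfolding juntas_def by blast
    have "T g \<in> ?C' \<rightarrow>\<^sub>E carrier H"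
      using g pull_in hom_in_carrier[OF \<phi>(1)] by (auto simp: T_def)
    moreover have "depends_only_on ?C' I (T g)"
      unfolding depends_only_on_def
    proof (intro ballI impI)
      fix x y assume xy: "x \<in> ?C'" "y \<in> ?C'" "\<forall>i\<in>I. x i = y i"
      have "\<forall>i\<in>I. pull x i = pull y i" using xy I by (auto simp: pull_def)
      then have "g (pull x) = g (pull y)"
        using I(3) pull_in xy unfolding depends_only_on_def by blast
      then show "T g x = T g y" using xy by (simp add: T_def)
    qed
    ultimately show ?thesis using I unfolding juntas_def by blast
  qed
  have T_junta_sum: "T P \<in> junta_sums d S' n H" if PJ: "P \<in> junta_sums d S n G" for P
  proof -
    obtain m :: nat and g where g: "\<forall>j<m. g j \<in> juntas d S n G"
      and P: "P = (\<lambda>x\<in>?C. finprod G (\<lambda>j. g j x) {..<m})"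
      using PJ unfolding junta_sums_def by blast
    have "T P = (\<lambda>x\<in>?C'. finprod H (\<lambda>j. T (g j) x) {..<m})"
      unfolding T_def
    proof (rule restrict_ext)
      fix x assume x: "x \<in> ?C'"
      have "g j (pull x) \<in> carrier G" if "j < m" for j
        using g that pull_in[OF x] unfolding juntas_def by blast
      from hom_finprod_lessThan[OF G H \<phi>(1) this]
      show "\<phi> (P (pull x)) = finprod H (\<lambda>j. (\<lambda>x\<in>?C'. \<phi> (g j (pull x))) x) {..<m}"
        using x pull_in[OF x] by (simp add: P)
    qed
    moreover have "\<forall>j<m. T (g j) \<in> juntas d S' n H" using g T_junta by blast
    ultimately show ?thesis
      unfolding junta_sums_def by (intro CollectI exI[of _ m] exI[of _ "\<lambda>j. T (g j)"] conjI)
  qed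
  have T_dist: "rel_dist ?C' (T f) (T P) = rel_dist ?C f P"
    if fP: "f \<in> ?C \<rightarrow> carrier G" "P \<in> ?C \<rightarrow> carrier G" for f P
  proof -
    have "pull ` {x \<in> ?C'. T f x \<noteq> T P x} = {x \<in> ?C. f x \<noteq> P x}"
      unfolding bij_betw_imp_surj_on[OF pull, symmetric] using T_eq[OF fP] by auto
    then have "bij_betw pull {x \<in> ?C'. T f x \<noteq> T P x} {x \<in> ?C. f x \<noteq> P x}"
      by (intro bij_betw_subset[OF pull]) auto
    from bij_betw_same_card[OF this] bij_betw_same_card[OF pull] show ?thesis
      by (simp add: rel_dist_def)
  qed
  show ?thesis
    unfolding list_decodable_def
  proof
    fix f assume f: "f \<in> ?C \<rightarrow> carrier G"
    let ?A = "{P \<in> junta_sums d S n G. rel_dist ?C f P \<le> r}"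
    let ?A' = "{P \<in> junta_sums d S' n H. rel_dist ?C' (T f) P \<le> r}"
    have "T f \<in> ?C' \<rightarrow> carrier H"
      using f pull_in hom_in_carrier[OF \<phi>(1)] by (auto simp: T_def)
    then have A': "finite ?A'" "card ?A' \<le> L" using ld unfolding list_decodable_def by auto
    have A_fun: "P \<in> ?C \<rightarrow>\<^sub>E carrier G" if "P \<in> ?A" for P
      using that junta_sums_funcset[OF G] by blast
    have inj: "inj_on T ?A"
    proof (rule inj_onI)
      fix P Q assume PQ: "P \<in> ?A" "Q \<in> ?A" "T P = T Q"
      show "P = Q"
      proof (rule PiE_ext[OF A_fun[OF PQ(1)] A_fun[OF PQ(2)]])
        fix y assume "y \<in> ?C"
        then obtain x where "x \<in> ?C'" "y = pull x" using pull by (auto simp: bij_betw_def)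
        then show "P y = Q y" using T_eq[of P Q x] A_fun PQ by auto
      qed
    qed
    have "T ` ?A \<subseteq> ?A'"
    proof (intro image_subsetI CollectI conjI)
      fix P assume P: "P \<in> ?A"
      then show "T P \<in> junta_sums d S' n H" using T_junta_sum by blast
      have "P \<in> ?C \<rightarrow> carrier G" using A_fun[OF P] by blast
      then show "rel_dist ?C' (T f) (T P) \<le> r" using T_dist[OF f] P by auto
    qed
    with inj A' show "finite ?A \<and> card ?A \<le> L"
      by (meson card_inj_on_le finite_imageD finite_subset order_trans)
  qed
qed

section \<open>Reduction to countable groups and to carriers in \<open>nat\<close>\<close>

lemma (in group) countable_generate:
  assumes "countable W" "W \<subseteq> carrier G"
  shows "countable (generate G W)"
proof -
  \<comment> \<open>Evaluation of words: words over a countable set of letters are countable, and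
    those in \<open>W\<close> and its inverses exhaust the generated subgroup.\<close>
  define ev where "ev ws = foldr (\<otimes>) ws \<one>" for ws
  let ?X = "W \<union> m_inv G ` W"
  have X: "?X \<subseteq> carrier G" using assms by auto
  have closed: "ev u \<in> carrier G" if "u \<in> lists ?X" for u
    using that by (induction u) (use X in \<open>auto simp: ev_def\<close>)
  have append: "ev u \<otimes> ev v = ev (u @ v)" if "u \<in> lists ?X" "v \<in> lists ?X" for u v
    using that(1)
  proof (induction u)
    case Nil
    then show ?case using closed[OF that(2)] by (simp add: ev_def)
  next
    case (Cons w u)
    then have "w \<in> carrier G" "ev u \<in> carrier G" "ev v \<in> carrier G"
      using X closed that(2) by auto
    with Cons show ?case by (simp add: ev_def m_assoc)
  qed
  have "generate G W \<subseteq> ev ` lists ?X"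
  proof
    fix h assume "h \<in> generate G W"
    then show "h \<in> ev ` lists ?X"
    proof induction
      case one
      have "\<one> = ev []" by (simp add: ev_def)
      then show ?case by blast
    next
      case (incl h)
      then have "h = ev [h]" "[h] \<in> lists ?X" using assms by (auto simp: ev_def)
      then show ?case by blast
    next
      case (inv h)
      then have "inv h = ev [inv h]" "[inv h] \<in> lists ?X" using assms by (auto simp: ev_def)
      then show ?case by blast
    next
      case (eng h1 h2)
      then obtain u v where "u \<in> lists ?X" "v \<in> lists ?X" "h1 = ev u" "h2 = ev v" by blast
      then have "h1 \<otimes> h2 = ev (u @ v)" "u @ v \<in> lists ?X" using append by auto
      then show ?case by blast
    qed
  qed
  moreover have "countable (lists ?X)" using assms(1) by (intro countable_lists) auto
  ultimately show ?thesis by (meson countable_image countable_subset)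
qed

text \<open>Transport of structure along an injective numbering of the carrier.\<close>

lemma (in comm_group) countable_embeds_nat:
  assumes "countable (carrier G)"
  obtains N :: "nat monoid" and \<phi> where "comm_group N" "\<phi> \<in> hom G N" "inj_on \<phi> (carrier G)"
proof -
  define \<phi> where "\<phi> = to_nat_on (carrier G)"
  have inj: "inj_on \<phi> (carrier G)" unfolding \<phi>_def using assms by (rule inj_on_to_nat_on)
  define N :: "nat monoid" where "N = \<lparr>carrier = \<phi> ` carrier G,
    mult = (\<lambda>x y. \<phi> (inv_into (carrier G) \<phi> x \<otimes> inv_into (carrier G) \<phi> y)), one = \<phi> \<one>\<rparr>"
  have hom: "\<phi> \<in> hom G N" using inj by (auto simp: hom_def N_def)
  then have "\<phi> \<in> iso G N" using inj by (auto simp: iso_def bij_betw_def N_def)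
  from iso_imp_img_comm_group[OF this] have "comm_group N" by (simp add: N_def)
  with hom inj that show ?thesis by blast
qed

lemma list_decodable_if_nat:
  fixes S :: "'a set" and G :: "'g monoid"
  assumes nat: "\<And>(S' :: nat set) (N :: nat monoid). finite S' \<Longrightarrow> card S' = card S \<Longrightarrow> comm_group N \<Longrightarrow>
      list_decodable (cube S' n) (carrier N) (junta_sums d S' n N) r L"
    and S: "finite S" and G: "comm_group G"
  shows "list_decodable (cube S n) (carrier G) (junta_sums d S n G) r L"
  unfolding list_decodable_def
proof (intro ballI finite_if_finite_subsets_card_bdd)
  let ?C = "cube S n"
  interpret comm_group G by fact
  fix f A
  assume f: "f \<in> ?C \<rightarrow> carrier G" and A: "A \<subseteq> {P \<in> junta_sums d S n G. rel_dist ?C f P \<le> r}" "finite A"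
  have "\<forall>P\<in>A. \<exists>(m::nat) g. (\<forall>j<m. g j \<in> juntas d S n G) \<and> P = (\<lambda>x\<in>?C. finprod G (\<lambda>j. g j x) {..<m})"
    using A unfolding junta_sums_def by blast
  then obtain m :: "_ \<Rightarrow> nat" and g where g: "\<And>P j. P \<in> A \<Longrightarrow> j < m P \<Longrightarrow> g P j \<in> juntas d S n G"
    and P: "\<And>P. P \<in> A \<Longrightarrow> P = (\<lambda>x\<in>?C. finprod G (\<lambda>j. g P j x) {..<m P})"
    by metis
  \<comment> \<open>The values of the individual juntas are included, so that members of
    \<open>A\<close> are junta sums over the subgroup and not merely functions into it. The values
    of \<open>f\<close> make it a received word there.\<close>
  define W where "W = f ` ?C \<union> (\<Union>P\<in>A. \<Union>j<m P. g P j ` ?C)"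
  have "finite W" using finite_cube[OF S] A by (auto simp: W_def)
  have W: "W \<subseteq> carrier G" using f g unfolding W_def juntas_def by fastforce
  define H where "H = G\<lparr>carrier := generate G W\<rparr>"
  have sub: "subgroup (generate G W) G" by (rule generate_is_subgroup[OF W])
  have H: "comm_group H" unfolding H_def
    by (rule group.group_comm_groupI[OF subgroup.subgroup_is_group[OF sub is_group]])
      (use subgroup.subset[OF sub] m_comm in auto)
  have "countable (carrier H)" unfolding H_def using countable_generate[OF _ W] \<open>finite W\<close>
    by (simp add: countable_finite)
  then obtain N :: "nat monoid" and \<phi> where N: "comm_group N" "\<phi> \<in> hom H N" "inj_on \<phi> (carrier H)"
    using comm_group.countable_embeds_nat[OF H] by metis
  obtain \<beta> where "bij_betw \<beta> {0..<card S} S" using ex_bij_betw_nat_finite[OF S] by blast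
  from list_decodable_transfer[OF H N this nat]
  have ld: "list_decodable ?C (carrier H) (junta_sums d S n H) r L" using N by simp
  have "f \<in> ?C \<rightarrow> carrier H" by (auto simp: H_def W_def intro: generate.incl)
  then have *: "finite {P \<in> junta_sums d S n H. rel_dist ?C f P \<le> r}"
    "card {P \<in> junta_sums d S n H. rel_dist ?C f P \<le> r} \<le> L"
    using ld unfolding list_decodable_def by auto
  \<comment> \<open>As a homomorphism, the inclusion identifies finite products in \<open>H\<close>
    with those in \<open>G\<close>.\<close>
  have id: "(\<lambda>x. x) \<in> hom H G"
    using subgroup.subset[OF sub] by (auto simp: hom_def H_def)
  have "P \<in> junta_sums d S n H" if "P \<in> A" for P
  proof -
    have gH: "g P j x \<in> carrier H" if "j < m P" "x \<in> ?C" for j x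
      using \<open>P \<in> A\<close> that by (auto simp: H_def W_def intro!: generate.incl)
    have "g P j \<in> juntas d S n H" if "j < m P" for j
      using g[OF \<open>P \<in> A\<close> that] gH[OF that] unfolding juntas_def by (auto simp: PiE_iff)
    moreover have "P = (\<lambda>x\<in>?C. finprod H (\<lambda>j. g P j x) {..<m P})"
      by (subst P[OF that], rule restrict_ext)
        (use hom_finprod_lessThan[OF H comm_group_axioms id] gH in auto)
    ultimately show ?thesis unfolding junta_sums_def by blast
  qed
  then have "A \<subseteq> {P \<in> junta_sums d S n H. rel_dist ?C f P \<le> r}" using A by blast
  with * show "card A \<le> L" by (meson card_mono order_trans)
qed

theorem theorem5p4:
  fixes \<epsilon> :: real and s d n :: nat and S :: "'a set" and G :: "'g monoid"
  assumes "\<epsilon> > 0" and "s > 0" and "d > 0"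
    and "finite S" and "card S = s"
    and "comm_group G"
  shows "list_decodable (cube S n) (carrier G) (junta_sums d S n G)
           (1 / real s ^ d - \<epsilon>) (junta_list_size \<epsilon> s d)"
proof -
  obtain L where L: "\<forall>(S :: nat set) (G :: nat monoid) n f A.
      finite S \<and> card S = s \<and> comm_group G \<and> f \<in> cube S n \<rightarrow> carrier G \<and> finite A \<and>
      (\<forall>P\<in>A. grid.low_degree G S n d P \<and> rel_dist (cube S n) f P \<le> 1 / real s ^ d - \<epsilon>) \<longrightarrow> card A \<le> L"
    using exists_list_size[OF assms(2,1)] ..
  have "list_decodable (cube S n) (carrier G) (junta_sums d S n G) (1 / real s ^ d - \<epsilon>) L"
    if S: "finite S" "card S = s" and G: "comm_group G" for S :: "nat set" and G :: "nat monoid" and n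
    unfolding list_decodable_def
  proof (intro ballI finite_if_finite_subsets_card_bdd)
    fix f A
    assume f: "f \<in> cube S n \<rightarrow> carrier G" and "finite A"
      and A: "A \<subseteq> {P \<in> junta_sums d S n G. rel_dist (cube S n) f P \<le> 1 / real s ^ d - \<epsilon>}"
    interpret comm_group G by fact
    interpret grid G S n using S \<open>s > 0\<close> by unfold_locales auto
    show "card A \<le> L"
      by (rule L[rule_format, where S = S and G = G and n = n and f = f], intro conjI S G f \<open>finite A\<close>) (use A low_degree_junta_sum in blast)
  qed
  \<comment> \<open>The existence statement behind the \<open>SOME\<close> in
    \<open>junta_list_size\<close>, which fixes carriers in \<open>nat\<close>.\<close>
  then have "\<exists>L. \<forall>(S :: nat set) (G :: nat monoid) n. finite S \<and> card S = s \<and> comm_group G \<longrightarrow>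
      list_decodable (cube S n) (carrier G) (junta_sums d S n G) (1 / real s ^ d - \<epsilon>) L"
    by blast
  from someI_ex[OF this, folded junta_list_size_def]
  have "list_decodable (cube S' n) (carrier N) (junta_sums d S' n N)
      (1 / real s ^ d - \<epsilon>) (junta_list_size \<epsilon> s d)"
    if "finite S'" "card S' = card S" "comm_group N" for S' :: "nat set" and N :: "nat monoid"
    using that assms(5) by blast
  then show ?thesis
    using assms(4,6) by (rule list_decodable_if_nat)
qed

end
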